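(* Let $n$ be any positive integer and let $\mathcal{G}\le \mathrm{GL}_{2^n}(\mathbb{C})$ be a permutation-like matrix group of dimension $2^n$. If $\mathcal{G}$ contains a maximal cycle $C$ such that the cyclic subgroup $\langle C\rangle$ is normal in $\mathcal{G}$, then $\mathcal{G}$ is a permutation matrix group.
   Context: A matrix group of dimension $d$ is a subgroup $\mathcal{G}$ of $\mathrm{GL}_d(\mathbb{C})$. It is called a permutation-like matrix group if for every $A\in\mathcal{G}$ there is $T\in\mathrm{GL}_d(\mathbb{C})$ (possibly depending on $A$) such that $T^{-1}AT$ is a permutation matrix. It is called a permutation matrix group if there is a single $T\in\mathrm{GL}_d(\mathbb{C})$ such that $T^{-1}AT$ is a permutation matrix for every $A\in\mathcal{G}$. A $d\times d$ complex matrix is a maximal cycle if it is similar to the permutation matrix of a cycle of length $d$. *)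

theory Defs
  imports
    "HOL-Algebra.Generated_Groups"
    "HOL-Algebra.Coset"
    "HOL-Combinatorics.Cycles"
    "Jordan_Normal_Form.Jordan_Normal_Form"
begin

definition GL :: "nat \<Rightarrow> complex mat monoid"
  where "GL d = units_of (ring_mat TYPE(complex) d ())"

lemma group_GL: "group (GL d)"
proof -
  interpret ring "ring_mat TYPE(complex) d ()" by (rule ring_mat)
  show ?thesis unfolding GL_def by (rule units_group)
qed

lemma carrier_GL: "carrier (GL d) = {A \<in> carrier_mat d d. invertible_mat A}"
proof -
  have dim: "B \<in> carrier_mat d d"
    if "A \<in> carrier_mat d d" "A * B = 1\<^sub>m d" "B * A = 1\<^sub>m (dim_row B)" for A B :: "complex mat"
    using that by (metis carrier_matI carrier_matD(2) index_mult_mat(3) index_one_mat(3))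
  have "A \<in> carrier (GL d) \<longleftrightarrow>
      A \<in> carrier_mat d d \<and> (\<exists>B\<in>carrier_mat d d. B * A = 1\<^sub>m d \<and> A * B = 1\<^sub>m d)" for A
    unfolding GL_def units_of_carrier Units_def ring_mat_simps by (rule mem_Collect_eq)
  moreover have "A \<in> carrier_mat d d \<and> (\<exists>B\<in>carrier_mat d d. B * A = 1\<^sub>m d \<and> A * B = 1\<^sub>m d)
      \<longleftrightarrow> A \<in> carrier_mat d d \<and> invertible_mat A" for A :: "complex mat"
    unfolding invertible_mat_def inverts_mat_def square_mat.simps
    using dim[of A] carrier_matD by metis
  ultimately show ?thesis by blast
qed

text \<open>Column \<open>j\<close> of the matrix of \<open>\<sigma>\<close> is the unit vector with index \<open>\<sigma> j\<close>;
  indices run over \<open>{0..<d}\<close>.\<close>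

definition perm_mat :: "nat \<Rightarrow> (nat \<Rightarrow> nat) \<Rightarrow> complex mat"
  where "perm_mat d \<sigma> = mat d d (\<lambda>(i, j). if i = \<sigma> j then 1 else 0)"

definition is_permutation_matrix :: "nat \<Rightarrow> complex mat \<Rightarrow> bool"
  where "is_permutation_matrix d A \<longleftrightarrow> (\<exists>\<sigma>. \<sigma> permutes {0..<d} \<and> A = perm_mat d \<sigma>)"

definition permutation_like_matrix_group :: "nat \<Rightarrow> complex mat set \<Rightarrow> bool"
  where "permutation_like_matrix_group d G \<longleftrightarrow>
    subgroup G (GL d) \<and>
    (\<forall>A\<in>G. \<exists>T\<in>carrier (GL d). is_permutation_matrix d (inv\<^bsub>GL d\<^esub> T * A * T))"

definition permutation_matrix_group :: "nat \<Rightarrow> complex mat set \<Rightarrow> bool"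
  where "permutation_matrix_group d G \<longleftrightarrow>
    subgroup G (GL d) \<and>
    (\<exists>T\<in>carrier (GL d). \<forall>A\<in>G. is_permutation_matrix d (inv\<^bsub>GL d\<^esub> T * A * T))"

definition maximal_cycle :: "nat \<Rightarrow> complex mat \<Rightarrow> bool"
  where "maximal_cycle d C \<longleftrightarrow>
    (\<exists>cs. distinct cs \<and> set cs = {0..<d} \<and> similar_mat C (perm_mat d (cycle_of_list cs)))"

end

theory Submission
  imports Defs "HOL-Number_Theory.Cong"
begin

text \<open>Put \<open>N = 2\<^sup>n\<close> and diagonalize \<open>C\<close>; the group then becomes monomial, and \<open>A\<close> maps the \<open>j\<close>-th
  eigenline of \<open>C\<close> to the \<open>k j\<close>-th one, where \<open>C A = A C\<^sup>k\<close>. Call \<open>A\<close> good if its trace is nonzero.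
  The traces of all \<open>A C\<^sup>m\<close> are nonnegative, and Parseval's identity shows that \<open>A\<close> is good iff
  it fixes pointwise every eigenline of \<open>C\<close> that it preserves, and that \<open>A C\<^sup>m\<close> is good for some \<open>m\<close>.
  Powers of good elements are good, because a power of a permutation has at least as many
  fixed points. If there is a subgroup \<open>H\<close> of good elements with \<open>\<G> = H \<langle>C\<rangle>\<close>, then \<open>H\<close> fixes a vector
  \<open>v\<close> all of whose coordinates are nonzero, and \<open>\<G>\<close> permutes the basis \<open>v, C v, \<dots>, C\<^sup>N\<^sup>-\<^sup>1 v\<close>.

  The exponents \<open>k\<close> form a subgroup of the units modulo \<open>2\<^sup>n\<close>. If it is cyclic, the powers of one good
  element serve as \<open>H\<close>. Otherwise it is generated by \<open>-1\<close> and some \<open>l\<close> congruent to \<open>1\<close> modulo \<open>4\<close>, and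
  good elements over these two can be chosen to commute.\<close>

section \<open>Permutation matrices and roots of unity\<close>

lemma index_mat_mult_sum:
  assumes "A \<in> carrier_mat m n" "B \<in> carrier_mat n l" "i < m" "j < l"
  shows "(A * B) $$ (i, j) = (\<Sum>k<n. A $$ (i, k) * B $$ (k, j))"
  using assms by (auto simp: scalar_prod_def atLeast0LessThan intro!: sum.cong)

definition mat_trace :: "'a::comm_semiring_1 mat \<Rightarrow> 'a"
  where "mat_trace A = (\<Sum>i<dim_row A. A $$ (i, i))"

lemma mat_trace_comm:
  assumes "A \<in> carrier_mat n m" "B \<in> carrier_mat m n"
  shows "mat_trace (A * B) = mat_trace (B * A)"
proof -
  have "mat_trace (A * B) = (\<Sum>i<n. \<Sum>k<m. A $$ (i, k) * B $$ (k, i))"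
    using assms by (auto simp: mat_trace_def index_mat_mult_sum[OF assms] simp del: index_mult_mat(1) intro!: sum.cong)
  also have "\<dots> = (\<Sum>k<m. \<Sum>i<n. B $$ (k, i) * A $$ (i, k))"
    by (subst sum.swap) (simp add: mult.commute)
  also have "\<dots> = mat_trace (B * A)"
    using assms by (auto simp: mat_trace_def index_mat_mult_sum[OF assms(2,1)] simp del: index_mult_mat(1) intro!: sum.cong)
  finally show ?thesis .
qed

lemma mat_trace_similar:
  assumes "similar_mat A B"
  shows "mat_trace A = mat_trace B"
proof -
  obtain n P Q where c: "A \<in> carrier_mat n n" "B \<in> carrier_mat n n" "P \<in> carrier_mat n n"
      "Q \<in> carrier_mat n n" and QP: "Q * P = 1\<^sub>m n" and A: "A = P * B * Q"
    using similar_matD[OF assms] by auto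
  have "mat_trace A = mat_trace (P * (B * Q))" using A c by (simp add: assoc_mult_mat)
  also have "\<dots> = mat_trace (B * Q * P)" by (rule mat_trace_comm) (use c in auto)
  also have "B * Q * P = B" using c QP by (simp add: assoc_mult_mat)
  finally show ?thesis .
qed

lemma similar_mat_one:
  assumes "A \<in> carrier_mat n n" "similar_mat A (1\<^sub>m n)"
  shows "A = 1\<^sub>m n"
proof -
  obtain P Q where wit: "similar_mat_wit A (1\<^sub>m n) P Q"
    using assms(2) unfolding similar_mat_def by blast
  note w = similar_mat_witD2[OF assms(1) wit]
  have "A = P * Q" using w(3) right_mult_one_mat[OF w(6)] by (rule trans[OF _ arg_cong])
  then show ?thesis using w(1) by (rule trans)
qed

section \<open>Permutation matrices and their traces\<close>

lemma perm_mat_carrier [simp]: "perm_mat n \<sigma> \<in> carrier_mat n n"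
  by (simp add: perm_mat_def)

lemma perm_mat_dims [simp]: "dim_row (perm_mat n \<sigma>) = n" "dim_col (perm_mat n \<sigma>) = n"
  by (simp_all add: perm_mat_def)

lemma perm_mat_index [simp]:
  "i < n \<Longrightarrow> j < n \<Longrightarrow> perm_mat n \<sigma> $$ (i, j) = (if i = \<sigma> j then 1 else 0)"
  by (simp add: perm_mat_def)

lemma perm_mat_id: "perm_mat n id = 1\<^sub>m n"
  by (auto intro!: eq_matI)

lemma mult_perm_mat_index:
  assumes "A \<in> carrier_mat m n" "\<tau> j < n" "i < m" "j < n"
  shows "(A * perm_mat n \<tau>) $$ (i, j) = A $$ (i, \<tau> j)"
proof -
  have "(A * perm_mat n \<tau>) $$ (i, j) = (\<Sum>k<n. A $$ (i, k) * (if k = \<tau> j then 1 else 0))"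
    using assms by (simp add: index_mat_mult_sum[OF assms(1) perm_mat_carrier] del: index_mult_mat(1))
  also have "\<dots> = (\<Sum>k<n. if k = \<tau> j then A $$ (i, k) else 0)"
    by (rule sum.cong) auto
  also have "\<dots> = A $$ (i, \<tau> j)" using assms by simp
  finally show ?thesis .
qed

lemma perm_mat_mult:
  assumes "\<tau> permutes {0..<n}"
  shows "perm_mat n \<sigma> * perm_mat n \<tau> = perm_mat n (\<sigma> \<circ> \<tau>)"
proof -
  have "\<tau> j < n" if "j < n" for j using permutes_in_image[OF assms, of j] that by simp
  then show ?thesis
    by (intro eq_matI)
      (simp_all add: mult_perm_mat_index[OF perm_mat_carrier] del: index_mult_mat(1))
qed

lemma perm_mat_pow:
  assumes "\<sigma> permutes {0..<n}"
  shows "perm_mat n \<sigma> ^\<^sub>m s = perm_mat n (\<sigma> ^^ s)"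
proof (induction s)
  case 0
  show ?case using perm_mat_id[of n] by (simp add: id_def)
next
  case (Suc s)
  have "perm_mat n \<sigma> ^\<^sub>m Suc s = perm_mat n (\<sigma> ^^ s) * perm_mat n \<sigma>" by (simp add: Suc)
  also have "\<dots> = perm_mat n (\<sigma> ^^ Suc s)"
    unfolding perm_mat_mult[OF assms] funpow_Suc_right ..
  finally show ?case .
qed

lemma mat_trace_perm_mat: "mat_trace (perm_mat n \<sigma>) = of_nat (card {i. i < n \<and> \<sigma> i = i})"
proof -
  have "mat_trace (perm_mat n \<sigma>) = (\<Sum>i<n. if \<sigma> i = i then 1 else 0)"
    by (auto simp: mat_trace_def eq_commute intro!: sum.cong)
  also have "\<dots> = of_nat (card ({..<n} \<inter> {i. \<sigma> i = i}))"
    by (simp add: sum.If_cases)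
  also have "{..<n} \<inter> {i. \<sigma> i = i} = {i. i < n \<and> \<sigma> i = i}" by auto
  finally show ?thesis .
qed

lemma funpow_fixpoint: "f x = x \<Longrightarrow> (f ^^ s) x = x"
  by (induction s) auto

text \<open>Similarity passes to powers, so one permutation \<open>\<sigma>\<close> serves all
  exponents and the traces of the powers of \<open>A\<close> are read off from its fixed
  points.\<close>

lemma mat_trace_pow_similar_perm_mat:
  assumes "\<sigma> permutes {0..<n}" "similar_mat A (perm_mat n \<sigma>)"
  shows "mat_trace (A ^\<^sub>m s) = of_nat (card {i. i < n \<and> (\<sigma> ^^ s) i = i})"
proof -
  have "similar_mat (A ^\<^sub>m s) (perm_mat n \<sigma> ^\<^sub>m s)"
    using assms(2) similar_mat_wit_pow unfolding similar_mat_def by blast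
  from mat_trace_similar[OF this] show ?thesis
    by (simp add: perm_mat_pow[OF assms(1)] mat_trace_perm_mat)
qed

section \<open>Roots of unity and powers of the diagonalized cycle\<close>

definition rot :: "nat \<Rightarrow> int \<Rightarrow> complex"
  where "rot N j = cis (2 * pi * of_int j / of_nat N)"

lemma rot_0 [simp]: "rot N 0 = 1"
  by (simp add: rot_def)

lemma rot_add: "rot N (a + b) = rot N a * rot N b"
  by (simp add: rot_def cis_mult add_divide_distrib ring_distribs)

lemma norm_rot [simp]: "norm (rot N j) = 1"
  by (simp add: rot_def)

lemma rot_neq_0 [simp]: "rot N j \<noteq> 0"
  by (simp add: rot_def)

lemma rot_minus: "rot N (- j) = cnj (rot N j)"
  by (simp add: rot_def cis_cnj)

lemma rot_minus_mult [simp]: "rot N (- j) * rot N j = 1" "rot N j * rot N (- j) = 1"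
  by (simp_all add: rot_add[symmetric])

lemma rot_power: "rot N j ^ m = rot N (j * int m)"
  by (induction m) (simp_all add: rot_add ring_distribs)

lemma rot_eq_1_iff:
  assumes "N > 0"
  shows "rot N j = 1 \<longleftrightarrow> int N dvd j"
proof
  assume "rot N j = 1"
  then have "cos (2 * pi * of_int j / of_nat N) = 1" by (simp add: rot_def complex_eq_iff)
  then obtain k :: int where "2 * pi * of_int j / of_nat N = of_int k * 2 * pi"
    by (auto simp: cos_one_2pi_int)
  then have "of_int j = (of_int (k * int N) :: real)" using assms by (simp add: field_simps)
  then have "j = k * int N" by (simp only: of_int_eq_iff)
  then show "int N dvd j" by simp
next
  assume "int N dvd j"
  then obtain k where j: "j = int N * k" by (elim dvdE)
  have "2 * pi * of_int j / of_nat N = 2 * pi * of_int k" using assms by (simp add: j)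
  then show "rot N j = 1" by (simp add: rot_def cis_multiple_2pi)
qed

lemma rot_eq_iff:
  assumes "N > 0"
  shows "rot N i = rot N j \<longleftrightarrow> [i = j] (mod int N)"
proof -
  have "rot N i = rot N (i - j) * rot N j" by (simp flip: rot_add)
  then have "rot N i = rot N j \<longleftrightarrow> rot N (i - j) = 1" by simp
  then show ?thesis by (simp add: rot_eq_1_iff[OF assms] cong_iff_dvd_diff)
qed

text \<open>A geometric sum whose ratio is an \<open>N\<close>-th root of unity. This orthogonality
  of the characters of a cyclic group underlies the Fourier inversions and Parseval's identity
  below.\<close>

lemma sum_rot:
  assumes "N > 0"
  shows "(\<Sum>m<N. rot N (j * int m)) = (if int N dvd j then of_nat N else 0)"
proof (cases "int N dvd j")
  case True
  then have "rot N (j * int m) = 1" for m by (simp add: rot_eq_1_iff[OF assms])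
  with True show ?thesis by simp
next
  case False
  then have "rot N j \<noteq> 1" by (simp add: rot_eq_1_iff[OF assms])
  then have "(\<Sum>m<N. rot N j ^ m) = (rot N j ^ N - 1) / (rot N j - 1)" by (rule geometric_sum)
  moreover have "rot N j ^ N = 1" by (simp add: rot_power rot_eq_1_iff[OF assms])
  ultimately show ?thesis using False by (simp add: rot_power)
qed

text \<open>The \<open>j\<close>-th power of the maximal cycle in an eigenbasis: its eigenvalues are
  the \<open>N\<close>-th roots of unity, each with multiplicity one. Integer exponents include the
  inverse powers.\<close>

definition diag_rot :: "nat \<Rightarrow> int \<Rightarrow> complex mat"
  where "diag_rot N j = mat_diag N (\<lambda>i. rot N (j * int i))"

lemma diag_rot_carrier [simp]: "diag_rot N j \<in> carrier_mat N N"
  by (simp add: diag_rot_def)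

lemma diag_rot_dims [simp]: "dim_row (diag_rot N j) = N" "dim_col (diag_rot N j) = N"
  by (simp_all add: diag_rot_def mat_diag_def)

lemma diag_rot_index [simp]:
  "a < N \<Longrightarrow> b < N \<Longrightarrow> diag_rot N j $$ (a, b) = (if a = b then rot N (j * int a) else 0)"
  by (simp add: diag_rot_def mat_diag_def)

lemma diag_rot_0 [simp]: "diag_rot N 0 = 1\<^sub>m N"
  by (simp add: diag_rot_def)

lemma diag_rot_mult: "diag_rot N i * diag_rot N j = diag_rot N (i + j)"
  by (simp add: diag_rot_def rot_add ring_distribs)

lemma diag_rot_mult_index:
  assumes "A \<in> carrier_mat N m" "a < N" "b < m"
  shows "(diag_rot N j * A) $$ (a, b) = rot N (j * int a) * A $$ (a, b)"
  using assms by (simp add: diag_rot_def mat_diag_mult_left[OF assms(1)])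

lemma mult_diag_rot_index:
  assumes "A \<in> carrier_mat m N" "a < m" "b < N"
  shows "(A * diag_rot N j) $$ (a, b) = A $$ (a, b) * rot N (j * int b)"
  using assms by (simp add: diag_rot_def mat_diag_mult_right[OF assms(1)])

section \<open>Good elements of the diagonalized group\<close>

text \<open>The group as seen from an eigenbasis of the maximal cycle, which has become
  \<open>diag_rot N 1\<close>. \<open>G_normalizes\<close> expresses normality of the subgroup of
  its powers as a commutation rule, without inverse matrices.\<close>

locale monomial_group =
  fixes N :: nat and G :: "complex mat set"
  assumes N_pos: "N > 0"
    and G_carrier: "A \<in> G \<Longrightarrow> A \<in> carrier_mat N N"
    and G_mult: "A \<in> G \<Longrightarrow> B \<in> G \<Longrightarrow> A * B \<in> G"
    and G_inverse: "A \<in> G \<Longrightarrow> \<exists>B\<in>G. A * B = 1\<^sub>m N \<and> B * A = 1\<^sub>m N"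
    and G_diag_rot: "diag_rot N j \<in> G"
    and G_normalizes: "A \<in> G \<Longrightarrow> \<exists>k. diag_rot N 1 * A = A * diag_rot N k"
    and G_perm_like: "A \<in> G \<Longrightarrow> \<exists>\<sigma>. \<sigma> permutes {0..<N} \<and> similar_mat A (perm_mat N \<sigma>)"
begin

text \<open>Conjugation by \<open>A\<close> raises the cycle to the power \<open>k\<close>. Only the
  class of \<open>k\<close> modulo \<open>N\<close> matters, so one \<open>A\<close> lies over many
  integers.\<close>

definition over :: "int \<Rightarrow> complex mat \<Rightarrow> bool"
  where "over k A \<longleftrightarrow> A \<in> G \<and> diag_rot N 1 * A = A * diag_rot N k"

definition good :: "complex mat \<Rightarrow> bool"
  where "good A \<longleftrightarrow> A \<in> G \<and> mat_trace A \<noteq> 0"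

text \<open>The eigenlines that an element over \<open>k\<close> maps to themselves.\<close>

definition fixed_idx :: "int \<Rightarrow> nat set"
  where "fixed_idx k = {i. i < N \<and> [k * int i = int i] (mod int N)}"

lemma over_in_G: "over k A \<Longrightarrow> A \<in> G"
  by (simp add: over_def)

lemma good_in_G: "good A \<Longrightarrow> A \<in> G"
  by (simp add: good_def)

lemma ex_over: "A \<in> G \<Longrightarrow> \<exists>k. over k A"
  using G_normalizes by (auto simp: over_def)

lemma G_one: "1\<^sub>m N \<in> G"
  using G_diag_rot[of 0] by simp

lemma G_assoc: "A \<in> G \<Longrightarrow> B \<in> G \<Longrightarrow> C \<in> G \<Longrightarrow> A * B * C = A * (B * C)"
  using G_carrier assoc_mult_mat by blast

lemma G_pow: "A \<in> G \<Longrightarrow> A ^\<^sub>m s \<in> G"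
  by (induction s) (auto simp: G_one G_mult dest: G_carrier)

lemma index_cong_eq: "i < N \<Longrightarrow> j < N \<Longrightarrow> [int i = int j] (mod int N) \<Longrightarrow> i = j"
  by (simp add: cong_int_iff cong_less_modulus_unique_nat)

section \<open>Monomial shape and multiplication of exponents\<close>

lemma over_nonzero:
  assumes "over k A" "i < N" "j < N" "A $$ (i, j) \<noteq> 0"
  shows "[int i = k * int j] (mod int N)"
proof -
  have c: "A \<in> carrier_mat N N" using assms(1) by (simp add: over_in_G G_carrier)
  have "(diag_rot N 1 * A) $$ (i, j) = (A * diag_rot N k) $$ (i, j)"
    using assms(1) by (simp add: over_def)
  \<comment> \<open>The nonzero entry cancels, which leaves an equality of two roots of
    unity.\<close>
  then have "rot N (int i) * A $$ (i, j) = A $$ (i, j) * rot N (k * int j)"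
    unfolding diag_rot_mult_index[OF c assms(2,3)] mult_diag_rot_index[OF c assms(2,3)] by simp
  then show ?thesis using assms(4) by (simp add: rot_eq_iff[OF N_pos])
qed

lemma nonzero_unique:
  assumes "A \<in> G" "i < N" "i' < N" "j < N" "A $$ (i, j) \<noteq> 0" "A $$ (i', j) \<noteq> 0"
  shows "i = i'"
proof -
  obtain k where "over k A" using ex_over[OF assms(1)] ..
  from over_nonzero[OF this assms(2,4,5)] over_nonzero[OF this assms(3,4,6)]
  show ?thesis using assms index_cong_eq by (meson cong_sym cong_trans)
qed

lemma column_nonzero:
  assumes "A \<in> G" "j < N"
  shows "\<exists>i<N. A $$ (i, j) \<noteq> 0"
proof (rule ccontr)
  assume "\<not> ?thesis"
  then have z: "A $$ (i, j) = 0" if "i < N" for i using that by auto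
  obtain B where B: "B \<in> G" "B * A = 1\<^sub>m N" using G_inverse[OF assms(1)] by blast
  have "(B * A) $$ (j, j) = 0"
    using index_mat_mult_sum[OF G_carrier[OF B(1)] G_carrier[OF assms(1)] assms(2,2)] z by simp
  then show False using assms(2) B(2) by simp
qed

lemma row_nonzero:
  assumes "A \<in> G" "i < N"
  shows "\<exists>j<N. A $$ (i, j) \<noteq> 0"
proof (rule ccontr)
  assume "\<not> ?thesis"
  then have z: "A $$ (i, j) = 0" if "j < N" for j using that by auto
  obtain B where B: "B \<in> G" "A * B = 1\<^sub>m N" using G_inverse[OF assms(1)] by blast
  have "(A * B) $$ (i, i) = 0"
    using index_mat_mult_sum[OF G_carrier[OF assms(1)] G_carrier[OF B(1)] assms(2,2)] z by simp
  then show False using assms(2) B(2) by simp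
qed

text \<open>Column \<open>l\<close> of \<open>B\<close> has its only nonzero entry in row
  \<open>j\<close>, so a single term of the sum survives.\<close>

lemma mult_index:
  assumes "A \<in> carrier_mat M N" "B \<in> G" "i < M" "j < N" "l < N" "B $$ (j, l) \<noteq> 0"
  shows "(A * B) $$ (i, l) = A $$ (i, j) * B $$ (j, l)"
proof -
  have "B $$ (k, l) = 0" if "k < N" "k \<noteq> j" for k
    using nonzero_unique[OF assms(2) that(1) assms(4,5) _ assms(6)] that(2) by blast
  then have "(\<Sum>k<N. A $$ (i, k) * B $$ (k, l)) = (\<Sum>k\<in>{j}. A $$ (i, k) * B $$ (k, l))"
    using assms(4) by (intro sum.mono_neutral_right) auto
  then show ?thesis
    by (simp add: index_mat_mult_sum[OF assms(1) G_carrier[OF assms(2)] assms(3,5)]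
        del: index_mult_mat(1))
qed

text \<open>The relation passes to powers entrywise: where \<open>A\<close> is nonzero, the
  congruence between row and column index is multiplied by \<open>a\<close>. This covers negative
  \<open>a\<close> as well.\<close>

lemma diag_rot_commute:
  assumes "over k A"
  shows "diag_rot N a * A = A * diag_rot N (k * a)"
proof (rule eq_matI)
  have c: "A \<in> carrier_mat N N" using assms by (simp add: over_in_G G_carrier)
  show "dim_row (diag_rot N a * A) = dim_row (A * diag_rot N (k * a))"
    "dim_col (diag_rot N a * A) = dim_col (A * diag_rot N (k * a))"
    using c by (simp_all add: diag_rot_def mat_diag_def)
  fix i j assume "i < dim_row (A * diag_rot N (k * a))" "j < dim_col (A * diag_rot N (k * a))"
  then have ij: "i < N" "j < N" using c by (simp_all add: diag_rot_def mat_diag_def)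
  have "rot N (a * int i) = rot N (k * a * int j)" if "A $$ (i, j) \<noteq> 0"
  proof -
    have "[a * int i = a * (k * int j)] (mod int N)"
      using over_nonzero[OF assms ij that] by (rule cong_scalar_left)
    then show ?thesis by (simp add: rot_eq_iff[OF N_pos] ac_simps)
  qed
  then show "(diag_rot N a * A) $$ (i, j) = (A * diag_rot N (k * a)) $$ (i, j)"
    unfolding diag_rot_mult_index[OF c ij] mult_diag_rot_index[OF c ij] by auto
qed

lemma over_mult:
  assumes "over k A" "over l B"
  shows "over (k * l) (A * B)"
proof -
  note G = over_in_G[OF assms(1)] over_in_G[OF assms(2)]
  have "diag_rot N 1 * (A * B) = diag_rot N 1 * A * B" using G by (simp add: G_assoc G_diag_rot)
  also have "\<dots> = A * (diag_rot N k * B)"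
    using G assms(1) by (simp add: over_def G_assoc G_diag_rot)
  also have "\<dots> = A * B * diag_rot N (k * l)"
    unfolding diag_rot_commute[OF assms(2)] using G by (simp add: G_assoc G_diag_rot mult.commute)
  finally show ?thesis using G by (simp add: over_def G_mult)
qed

lemma diag_rot_cong: "[i = j] (mod int N) \<Longrightarrow> diag_rot N i = diag_rot N j"
  by (rule eq_matI)
    (auto simp: diag_rot_def mat_diag_def rot_eq_iff[OF N_pos] intro: cong_scalar_right)

lemma over_cong: "over k A \<Longrightarrow> [k = l] (mod int N) \<Longrightarrow> over l A"
  using diag_rot_cong[of k l] by (simp add: over_def)

lemma over_diag_rot: "over 1 (diag_rot N j)"
  by (simp add: over_def G_diag_rot diag_rot_mult add.commute)

lemma over_mult_diag_rot: "over k A \<Longrightarrow> over k (A * diag_rot N j)"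
  using over_mult[OF _ over_diag_rot] by simp

lemma over_pow:
  assumes "over k A"
  shows "over (k ^ s) (A ^\<^sub>m s)"
proof (induction s)
  case 0
  show ?case using over_diag_rot[of 0] G_carrier[OF over_in_G[OF assms]] by simp
next
  case (Suc s)
  then show ?case using over_mult[OF Suc assms] by (simp add: mult.commute)
qed

text \<open>The inverse of \<open>k\<close> is the column of a nonzero entry in row
  \<open>1\<close>. For \<open>N = 1\<close> there is no such row.\<close>

lemma over_unit:
  assumes "over k A"
  shows "\<exists>k'. [k * k' = 1] (mod int N)"
proof (cases "N = 1")
  case True
  then show ?thesis by auto
next
  case False
  with N_pos have "1 < N" by simp
  then obtain j where "j < N" "A $$ (1, j) \<noteq> 0"
    using row_nonzero[OF over_in_G[OF assms]] by blast
  from over_nonzero[OF assms \<open>1 < N\<close> this] have "[1 = k * int j] (mod int N)" by simp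
  then show ?thesis using cong_sym by blast
qed

text \<open>The identity matrix is over \<open>k * l\<close>, and its entry at \<open>(1, 1)\<close>
  turns this into the congruence.\<close>

lemma over_inverse:
  assumes "over k A" "B \<in> G" "A * B = 1\<^sub>m N" "over l B"
  shows "[k * l = 1] (mod int N)"
proof (cases "N = 1")
  case True
  then show ?thesis by simp
next
  case False
  with N_pos have "1 < N" by simp
  have "over (k * l) (1\<^sub>m N)" using over_mult[OF assms(1,4)] assms(3) by simp
  from over_nonzero[OF this \<open>1 < N\<close> \<open>1 < N\<close>] \<open>1 < N\<close> show ?thesis by (simp add: cong_sym_eq)
qed

section \<open>Diagonal entries and traces\<close>

lemma diag_nonzero_iff:
  assumes "over k A" "i < N"
  shows "A $$ (i, i) \<noteq> 0 \<longleftrightarrow> i \<in> fixed_idx k"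
proof
  assume "A $$ (i, i) \<noteq> 0"
  with over_nonzero[OF assms(1,2,2)] show "i \<in> fixed_idx k"
    using assms(2) by (simp add: fixed_idx_def cong_sym_eq)
next
  assume i: "i \<in> fixed_idx k"
  obtain j where j: "j < N" "A $$ (j, i) \<noteq> 0"
    using column_nonzero[OF over_in_G[OF assms(1)] assms(2)] by blast
  have "[int j = int i] (mod int N)"
    using over_nonzero[OF assms(1) j(1) assms(2) j(2)] i cong_trans by (auto simp: fixed_idx_def)
  then show "A $$ (i, i) \<noteq> 0" using index_cong_eq[OF j(1) assms(2)] j(2) by simp
qed

lemma trace_over:
  assumes "over k A"
  shows "mat_trace (A * diag_rot N j) = (\<Sum>i\<in>fixed_idx k. A $$ (i, i) * rot N (j * int i))"
proof -
  have c: "A \<in> carrier_mat N N" using assms by (simp add: over_in_G G_carrier)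
  have "mat_trace (A * diag_rot N j) = (\<Sum>i<N. A $$ (i, i) * rot N (j * int i))"
    using c unfolding mat_trace_def
    by (intro sum.cong) (simp_all add: mult_diag_rot_index[OF c] del: index_mult_mat(1))
  also have "\<dots> = (\<Sum>i\<in>fixed_idx k. A $$ (i, i) * rot N (j * int i))"
    using diag_nonzero_iff[OF assms]
    by (intro sum.mono_neutral_right) (auto simp: fixed_idx_def)
  finally show ?thesis .
qed

lemma trace_over_0:
  assumes "over k A"
  shows "mat_trace A = (\<Sum>i\<in>fixed_idx k. A $$ (i, i))"
  using trace_over[OF assms, of 0] G_carrier[OF over_in_G[OF assms]] by simp

lemma trace_nat: "A \<in> G \<Longrightarrow> \<exists>t::nat. mat_trace A = of_nat t"
  using G_perm_like mat_trace_similar mat_trace_perm_mat by metis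

text \<open>Some power of the permutation is the identity, and only the identity matrix is similar
  to the identity matrix.\<close>

lemma finite_order:
  assumes "A \<in> G"
  obtains r where "r > 0" "A ^\<^sub>m r = 1\<^sub>m N"
proof -
  obtain \<sigma> where \<sigma>: "\<sigma> permutes {0..<N}" "similar_mat A (perm_mat N \<sigma>)"
    using G_perm_like[OF assms] by blast
  have "permutation \<sigma>" using \<sigma>(1) by (auto simp: permutation_permutes)
  then obtain r where r: "\<sigma> ^^ r = id" "r > 0" by (rule permutation_is_nilpotent)
  have "similar_mat (A ^\<^sub>m r) (perm_mat N \<sigma> ^\<^sub>m r)"
    using \<sigma>(2) similar_mat_wit_pow unfolding similar_mat_def by blast
  then have "similar_mat (A ^\<^sub>m r) (1\<^sub>m N)"
    by (simp add: perm_mat_pow[OF \<sigma>(1)] r(1) perm_mat_id)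
  then have "A ^\<^sub>m r = 1\<^sub>m N" by (rule similar_mat_one[OF G_carrier[OF G_pow[OF assms]]])
  then show ?thesis using r(2) that by blast
qed

text \<open>A preserved eigenline of the cycle is also an eigenline of \<open>A\<close>, with the
  diagonal entry as eigenvalue. With finite order, the entry becomes a root of unity in
  \<open>norm_diag\<close>.\<close>

lemma diag_pow:
  assumes "A \<in> G" "i < N" "A $$ (i, i) \<noteq> 0"
  shows "(A ^\<^sub>m s) $$ (i, i) = A $$ (i, i) ^ s"
proof (induction s)
  case 0
  show ?case using G_carrier[OF assms(1)] assms(2) by simp
next
  case (Suc s)
  show ?case
    using mult_index[OF G_carrier[OF G_pow[OF assms(1)]] assms(1,2,2,2,3), of s] Suc by simp
qed

lemma norm_diag:
  assumes "A \<in> G" "i < N" "A $$ (i, i) \<noteq> 0"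
  shows "norm (A $$ (i, i)) = 1"
proof -
  obtain r where r: "r > 0" "A ^\<^sub>m r = 1\<^sub>m N" by (rule finite_order[OF assms(1)])
  have "A $$ (i, i) ^ r = 1" using diag_pow[OF assms, of r] r(2) assms(2) by simp
  then have "norm (A $$ (i, i)) ^ r = 1" by (simp flip: norm_power)
  then show ?thesis using r(1) power_eq_1_iff[of "norm (A $$ (i, i))" r] by simp
qed

lemma finite_fixed_idx [simp]: "finite (fixed_idx k)"
  by (simp add: fixed_idx_def)

lemma zero_fixed_idx [simp]: "0 \<in> fixed_idx k"
  using N_pos by (simp add: fixed_idx_def)

text \<open>The traces \<open>t m\<close> of \<open>A * C\<^sup>m\<close> are the Fourier coefficients of the diagonal of
  \<open>A\<close> on the eigenlines it fixes. They are nonnegative, bounded by the number \<open>g\<close> of these lines,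
  have sum \<open>N\<close> and, by Parseval, square sum \<open>N * g\<close>; hence each is \<open>0\<close> or \<open>g\<close>.\<close>

lemma trace_coefficients:
  fixes t :: "nat \<Rightarrow> nat"
  assumes A: "over k A" and t: "\<And>m. mat_trace (A * diag_rot N (int m)) = of_nat (t m)"
  shows "(\<Sum>m<N. t m) = N" "\<And>m. m < N \<Longrightarrow> t m = 0 \<or> t m = card (fixed_idx k)"
proof -
  define F where "F = fixed_idx k"
  have F: "finite F" "0 \<in> F" by (simp_all add: F_def)
  have FN: "i < N" if "i \<in> F" for i using that by (simp add: F_def fixed_idx_def)
  have nrm: "norm (A $$ (i, i)) = 1" if "i \<in> F" for i
    using norm_diag[OF over_in_G[OF A]] diag_nonzero_iff[OF A] that FN by (auto simp: F_def)
  have tF: "of_nat (t m) = (\<Sum>i\<in>F. A $$ (i, i) * rot N (int m * int i))" for m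
    using trace_over[OF A, of "int m"] t by (simp add: F_def)
  \<comment> \<open>Indices in \<open>F\<close> are below \<open>N\<close>, so orthogonality leaves
    only \<open>i = 0\<close> in the sum of the traces and, by \<open>ndvd2\<close>, only
    \<open>i = j\<close> in the sum of their squares.\<close>
  have ndvd: "N dvd i \<longleftrightarrow> i = 0" if "i \<in> F" for i
    using FN[OF that] by (auto dest: dvd_imp_le)
  have ndvd2: "int N dvd int i - int j \<longleftrightarrow> i = j" if "i \<in> F" "j \<in> F" for i j
    using index_cong_eq[OF FN[OF that(1)] FN[OF that(2)]] by (auto simp: cong_iff_dvd_diff)
  have "of_nat (\<Sum>m<N. t m) = (\<Sum>m<N. \<Sum>i\<in>F. A $$ (i, i) * rot N (int i * int m))"
    by (simp add: tF mult.commute)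
  also have "\<dots> = (\<Sum>i\<in>F. A $$ (i, i) * (\<Sum>m<N. rot N (int i * int m)))"
    by (subst sum.swap) (simp add: sum_distrib_left)
  also have "\<dots> = (\<Sum>i\<in>F. if i = 0 then A $$ (i, i) * of_nat N else 0)"
    by (intro sum.cong) (auto simp: sum_rot[OF N_pos] ndvd)
  also have "\<dots> = A $$ (0, 0) * of_nat N" using F by (simp add: sum.delta')
  \<comment> \<open>Only the modulus of the entry at \<open>(0, 0)\<close> is known here, so moduli
    are compared.\<close>
  finally have "norm (of_nat (\<Sum>m<N. t m) :: complex) = norm (A $$ (0, 0)) * of_nat N"
    by (simp add: norm_mult)
  then have "real (\<Sum>m<N. t m) = real N" unfolding norm_of_nat nrm[OF F(2)] by simp
  then show sum_t: "(\<Sum>m<N. t m) = N" by (simp only: of_nat_eq_iff)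
  \<comment> \<open>Each \<open>t m\<close> is real, so its square is \<open>t m\<close> times its
    conjugate, and the diagonal entries cancel for \<open>i = j\<close>.\<close>
  have "of_nat (\<Sum>m<N. t m * t m) = (\<Sum>m<N. of_nat (t m) * cnj (of_nat (t m)) :: complex)"
    by simp
  also have "\<dots> = (\<Sum>m<N. \<Sum>i\<in>F. \<Sum>j\<in>F. A $$ (i, i) * cnj (A $$ (j, j)) * rot N ((int i - int j) * int m))"
  proof (rule sum.cong[OF refl])
    fix m
    have "rot N ((int i - int j) * int m) = rot N (int m * int i) * cnj (rot N (int m * int j))" for i j
      by (simp flip: rot_minus rot_add add: algebra_simps)
    then show "of_nat (t m) * cnj (of_nat (t m)) = (\<Sum>i\<in>F. \<Sum>j\<in>F. A $$ (i, i) * cnj (A $$ (j, j)) * rot N ((int i - int j) * int m))"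
      unfolding tF cnj_sum sum_product by (simp add: ac_simps)
  qed
  also have "\<dots> = (\<Sum>i\<in>F. \<Sum>m<N. \<Sum>j\<in>F. A $$ (i, i) * cnj (A $$ (j, j)) * rot N ((int i - int j) * int m))"
    by (rule sum.swap)
  also have "\<dots> = (\<Sum>i\<in>F. \<Sum>j\<in>F. \<Sum>m<N. A $$ (i, i) * cnj (A $$ (j, j)) * rot N ((int i - int j) * int m))"
    by (rule sum.cong[OF refl]) (rule sum.swap)
  also have "\<dots> = (\<Sum>i\<in>F. \<Sum>j\<in>F. A $$ (i, i) * cnj (A $$ (j, j)) * (\<Sum>m<N. rot N ((int i - int j) * int m)))"
    by (simp add: sum_distrib_left)
  also have "\<dots> = (\<Sum>i\<in>F. \<Sum>j\<in>F. if i = j then of_nat N else 0)"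
  proof (intro sum.cong refl)
    fix i j assume ij: "i \<in> F" "j \<in> F"
    have "A $$ (i, i) * cnj (A $$ (i, i)) = 1"
      using nrm[OF ij(1)] by (simp add: complex_mult_cnj cmod_def)
    then show "A $$ (i, i) * cnj (A $$ (j, j)) * (\<Sum>m<N. rot N ((int i - int j) * int m))
        = (if i = j then of_nat N else 0)"
      using ndvd2[OF ij] by (auto simp: sum_rot[OF N_pos])
  qed
  also have "\<dots> = (of_nat (card F * N) :: complex)" using F by (simp add: sum.delta')
  finally have sq: "(\<Sum>m<N. t m * t m) = card F * N" by (simp only: of_nat_eq_iff)
  have le: "t m \<le> card F" for m
  proof -
    have "real (t m) = norm (of_nat (t m) :: complex)" by simp
    also have "\<dots> \<le> (\<Sum>i\<in>F. norm (A $$ (i, i) * rot N (int m * int i)))"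
      unfolding tF by (rule norm_sum)
    also have "\<dots> = real (card F)" by (simp add: norm_mult nrm)
    finally show ?thesis by simp
  qed
  \<comment> \<open>The products \<open>t m * (card F - t m)\<close> are natural numbers, with
    \<open>le\<close> excluding truncated subtraction. The two sums found above make their total
    zero, so each of them vanishes.\<close>
  have "(\<Sum>m<N. t m * (card F - t m)) + (\<Sum>m<N. t m * t m) = (\<Sum>m<N. t m * card F)"
    by (simp flip: sum.distrib distrib_left add: le)
  also have "\<dots> = card F * N" by (simp flip: sum_distrib_right add: sum_t)
  finally have "(\<Sum>m<N. t m * (card F - t m)) = 0" by (simp add: sq)
  then have "t m * (card F - t m) = 0" if "m < N" for m using that by simp
  then show "t m = 0 \<or> t m = card (fixed_idx k)" if "m < N" for m
    using that le[of m] by (force simp: F_def)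
qed

section \<open>Good elements\<close>

lemma ex_trace_coefficients:
  assumes "A \<in> G"
  shows "\<exists>t::nat \<Rightarrow> nat. \<forall>m. mat_trace (A * diag_rot N (int m)) = of_nat (t m)"
  by (rule choice) (use trace_nat[OF G_mult[OF assms G_diag_rot]] in blast)

lemma ex_good:
  assumes "A \<in> G"
  obtains m where "good (A * diag_rot N m)"
proof -
  obtain k where k: "over k A" using ex_over[OF assms] ..
  obtain t :: "nat \<Rightarrow> nat" where t: "mat_trace (A * diag_rot N (int m)) = of_nat (t m)" for m
    using ex_trace_coefficients[OF assms] by blast
  have "(\<Sum>m<N. t m) = N" by (rule trace_coefficients(1)[OF k t])
  with N_pos obtain m where "t m \<noteq> 0" by (metis neq0_conv sum.neutral)
  then have "good (A * diag_rot N (int m))" by (simp add: good_def t G_mult assms G_diag_rot)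
  then show ?thesis by (rule that)
qed

text \<open>By \<open>trace_coefficients\<close> a nonzero trace equals the number of its summands;
  these have modulus one, so all of them are \<open>1\<close>. Conversely, the trace then counts the
  preserved eigenlines, and index \<open>0\<close> is always among them.\<close>

lemma good_iff:
  assumes "A \<in> G"
  shows "good A \<longleftrightarrow> (\<forall>i<N. A $$ (i, i) \<noteq> 0 \<longrightarrow> A $$ (i, i) = 1)"
proof -
  obtain k where k: "over k A" using ex_over[OF assms] ..
  have card: "card (fixed_idx k) > 0" using zero_fixed_idx finite_fixed_idx card_gt_0_iff by blast
  have FN: "i < N" if "i \<in> fixed_idx k" for i using that by (simp add: fixed_idx_def)
  show ?thesis
  proof
    assume good: "good A"
    obtain t :: "nat \<Rightarrow> nat" where t: "mat_trace (A * diag_rot N (int m)) = of_nat (t m)" for m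
      using ex_trace_coefficients[OF assms] by blast
    have A: "A * diag_rot N (int 0) = A" using G_carrier[OF assms] by simp
    have "t 0 \<noteq> 0" using t[of 0] good unfolding A good_def by auto
    then have "mat_trace A = of_nat (card (fixed_idx k))"
      using trace_coefficients(2)[OF k t N_pos] t[of 0] unfolding A by auto
    \<comment> \<open>Real parts turn the extremal case of the triangle inequality into a vanishing
      sum of nonnegative terms.\<close>
    then have "Re (\<Sum>i\<in>fixed_idx k. A $$ (i, i)) = real (card (fixed_idx k))"
      by (simp add: trace_over_0[OF k])
    then have s: "(\<Sum>i\<in>fixed_idx k. 1 - Re (A $$ (i, i))) = 0" by (simp add: sum_subtractf)
    have nrm: "norm (A $$ (i, i)) = 1" if "i \<in> fixed_idx k" for i
      using norm_diag[OF assms] diag_nonzero_iff[OF k] FN that by blast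
    have le: "1 - Re (A $$ (i, i)) \<ge> 0" if "i \<in> fixed_idx k" for i
      using complex_Re_le_cmod[of "A $$ (i, i)"] nrm[OF that] by simp
    show "\<forall>i<N. A $$ (i, i) \<noteq> 0 \<longrightarrow> A $$ (i, i) = 1"
    proof (intro allI impI)
      fix i assume "i < N" "A $$ (i, i) \<noteq> 0"
      then have i: "i \<in> fixed_idx k" using diag_nonzero_iff[OF k] by blast
      then have re: "Re (A $$ (i, i)) = 1"
        using s sum_nonneg_eq_0_iff[OF finite_fixed_idx le] by auto
      have "(Re (A $$ (i, i)))\<^sup>2 + (Im (A $$ (i, i)))\<^sup>2 = 1"
        using nrm[OF i] by (simp flip: cmod_power2)
      then show "A $$ (i, i) = 1" using re by (simp add: complex_eq_iff)
    qed
  next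
    assume "\<forall>i<N. A $$ (i, i) \<noteq> 0 \<longrightarrow> A $$ (i, i) = 1"
    then have "mat_trace A = (\<Sum>i\<in>fixed_idx k. 1)"
      unfolding trace_over_0[OF k] using diag_nonzero_iff[OF k] FN by (intro sum.cong) auto
    then have "mat_trace A = of_nat (card (fixed_idx k))" by simp
    then show "good A" using card assms by (metis good_def less_irrefl of_nat_eq_0_iff)
  qed
qed

lemma good_diag: "good A \<Longrightarrow> i < N \<Longrightarrow> A $$ (i, i) \<noteq> 0 \<Longrightarrow> A $$ (i, i) = 1"
  using good_iff good_in_G by blast

lemma good_pow:
  assumes "good A"
  shows "good (A ^\<^sub>m s)"
proof -
  obtain \<sigma> where \<sigma>: "\<sigma> permutes {0..<N}" "similar_mat A (perm_mat N \<sigma>)"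
    using G_perm_like[OF good_in_G[OF assms]] by blast
  have "mat_trace A = of_nat (card {i. i < N \<and> \<sigma> i = i})"
    using mat_trace_similar[OF \<sigma>(2)] by (simp add: mat_trace_perm_mat)
  then have "card {i. i < N \<and> \<sigma> i = i} \<noteq> 0" using assms unfolding good_def by (metis of_nat_0)
  then obtain i where "i < N" "\<sigma> i = i" by (metis (mono_tags, lifting) card.empty empty_Collect_eq)
  then have "i \<in> {i. i < N \<and> (\<sigma> ^^ s) i = i}" by (simp add: funpow_fixpoint)
  moreover have "finite {i. i < N \<and> (\<sigma> ^^ s) i = i}" by simp
  ultimately have "card {i. i < N \<and> (\<sigma> ^^ s) i = i} \<noteq> 0" by (metis card_0_eq empty_iff)
  then show ?thesis
    by (simp add: good_def mat_trace_pow_similar_perm_mat[OF \<sigma>] G_pow[OF good_in_G[OF assms]])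
qed

section \<open>Elements with the same exponent\<close>

lemma good_over_1:
  assumes "good A" "over 1 A"
  shows "A = 1\<^sub>m N"
proof (rule eq_matI)
  have c: "A \<in> carrier_mat N N" using assms(1) by (simp add: good_in_G G_carrier)
  then show "dim_row A = dim_row (1\<^sub>m N)" "dim_col A = dim_col (1\<^sub>m N)" by auto
  fix i j assume "i < dim_row (1\<^sub>m N :: complex mat)" "j < dim_col (1\<^sub>m N :: complex mat)"
  then have ij: "i < N" "j < N" by auto
  \<comment> \<open>Over \<open>1\<close> every index is fixed, so goodness speaks about the whole
    diagonal.\<close>
  have "A $$ (i, i) = 1"
    using good_diag[OF assms(1) ij(1)] diag_nonzero_iff[OF assms(2) ij(1)] ij(1)
    by (simp add: fixed_idx_def)
  moreover have "A $$ (i, j) = 0" if "i \<noteq> j"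
    using over_nonzero[OF assms(2) ij] index_cong_eq[OF ij] that by auto
  ultimately show "A $$ (i, j) = 1\<^sub>m N $$ (i, j)" using ij by auto
qed

text \<open>The powers of the cycle are their own centralizer in \<open>G\<close>: a good translate
  of \<open>A\<close> is still over \<open>1\<close>, hence the identity.\<close>

lemma over_1:
  assumes "over 1 A"
  obtains j where "A = diag_rot N j"
proof -
  obtain m where "good (A * diag_rot N m)" using ex_good[OF over_in_G[OF assms]] .
  then have "A * diag_rot N m = 1\<^sub>m N" by (rule good_over_1) (rule over_mult_diag_rot[OF assms])
  then have "A * diag_rot N m * diag_rot N (- m) = diag_rot N (- m)"
    using left_mult_one_mat[OF diag_rot_carrier[of N "- m"]] by simp
  moreover have "A * diag_rot N m * diag_rot N (- m) = A"
    using over_in_G[OF assms] right_mult_one_mat[OF G_carrier[OF over_in_G[OF assms]]]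
    by (simp add: G_assoc G_diag_rot diag_rot_mult)
  ultimately show ?thesis using that by simp
qed

text \<open>The quotient of \<open>B\<close> by \<open>A\<close> is over \<open>1\<close>. To cover
  \<open>G\<close> by translates of \<open>H\<close> it therefore suffices to realize every exponent
  in \<open>H\<close>.\<close>

lemma over_same:
  assumes "over k A" "over k B"
  obtains j where "B = A * diag_rot N j"
proof -
  obtain A' where A': "A' \<in> G" "A * A' = 1\<^sub>m N" "A' * A = 1\<^sub>m N"
    using G_inverse[OF over_in_G[OF assms(1)]] by blast
  obtain l where l: "over l A'" using ex_over[OF A'(1)] ..
  have "over (l * k) (A' * B)" by (rule over_mult[OF l assms(2)])
  then have "over 1 (A' * B)"
    by (rule over_cong) (use over_inverse[OF assms(1) A'(1,2) l] in \<open>simp add: mult.commute\<close>)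
  then obtain j where "A' * B = diag_rot N j" by (rule over_1)
  then have "A * diag_rot N j = A * A' * B"
    using over_in_G[OF assms(1)] over_in_G[OF assms(2)] A'(1) by (simp add: G_assoc)
  also have "\<dots> = B" using A'(2) G_carrier[OF over_in_G[OF assms(2)]] by simp
  finally show ?thesis using that by metis
qed

text \<open>At a suitable preserved index both matrices have entry \<open>1\<close>, and the ratio
  of the two entries is a root of unity depending on \<open>j\<close>. The conclusion says that the
  shift is the one obtained by conjugating \<open>A\<close> with a power of the cycle.\<close>

lemma good_shift:
  assumes "good A" "over k A" "good (A * diag_rot N j)"
  obtains x where "[j = (k - 1) * x] (mod int N)"
proof -
  define g where "g = gcd (k - 1) (int N)"
  define q where "q = int N div g"
  have gq: "int N = g * q" by (simp add: q_def g_def)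
  have "g > 0" using N_pos by (simp add: g_def)
  moreover have "q > 0" using gq N_pos \<open>g > 0\<close> by (metis zero_less_mult_pos of_nat_0_less_iff)
  ultimately have gpos: "g > 0" "q > 0" .
  \<comment> \<open>The multiples of \<open>q\<close> are the solutions of
    \<open>(k - 1) * i = 0\<close> modulo \<open>N\<close>. Reduction is needed because
    \<open>q\<close> equals \<open>N\<close> when \<open>g = 1\<close>.\<close>
  define i where "i = nat (q mod int N)"
  have i: "i < N" "int i = q mod int N" using N_pos by (simp_all add: i_def nat_less_iff)
  have iq: "[int i = q] (mod int N)" by (simp add: i(2) cong_def)
  have "int N dvd (k - 1) * q"
    unfolding gq g_def[symmetric] by (simp add: mult_dvd_mono g_def)
  then have "[k * q = q] (mod int N)" by (simp add: cong_iff_dvd_diff left_diff_distrib)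
  then have "[k * int i = int i] (mod int N)"
    using iq by (meson cong_scalar_left cong_sym cong_trans)
  then have nz: "A $$ (i, i) \<noteq> 0"
    using diag_nonzero_iff[OF assms(2) i(1)] i(1) by (simp add: fixed_idx_def)
  have "A $$ (i, i) = 1" by (rule good_diag[OF assms(1) i(1) nz])
  moreover have e: "(A * diag_rot N j) $$ (i, i) = A $$ (i, i) * rot N (j * int i)"
    by (rule mult_diag_rot_index[OF G_carrier[OF good_in_G[OF assms(1)]] i(1,1)])
  moreover have "(A * diag_rot N j) $$ (i, i) = 1"
    by (rule good_diag[OF assms(3) i(1)]) (simp only: e, simp add: nz)
  ultimately have "rot N (j * int i) = 1" by simp
  then have "int N dvd j * int i" by (simp add: rot_eq_1_iff[OF N_pos])
  moreover have "[j * int i = j * q] (mod int N)" using iq by (rule cong_scalar_left)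
  ultimately have "int N dvd j * q" using cong_dvd_iff by (metis cong_0_iff cong_sym cong_trans)
  \<comment> \<open>The factor \<open>q\<close> cancels from \<open>g * q dvd j * q\<close>; Bezout
    then writes \<open>g\<close> as a multiple of \<open>k - 1\<close> modulo
    \<open>N\<close>.\<close>
  then have "g dvd j" using gpos unfolding gq by simp
  then obtain y where y: "j = g * y" by (elim dvdE)
  obtain u v where "u * (k - 1) + v * int N = g" using bezout_int unfolding g_def by blast
  then have "j = (u * (k - 1) + v * int N) * y" by (simp add: y)
  then have "j = (k - 1) * (u * y) + int N * (v * y)" by (simp add: algebra_simps)
  then have "[j = (k - 1) * (u * y)] (mod int N)" by (simp add: cong_iff_dvd_diff)
  then show ?thesis by (rule that)
qed

section \<open>Invariant vectors and the permuted basis\<close>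

definition permutable :: bool
  where "permutable \<longleftrightarrow> (\<exists>T\<in>carrier_mat N N. \<exists>T'\<in>carrier_mat N N. T * T' = 1\<^sub>m N \<and> T' * T = 1\<^sub>m N \<and>
    (\<forall>A\<in>G. is_permutation_matrix N (T' * A * T)))"

text \<open>Any two elements of \<open>H\<close> that carry line \<open>j\<close> to line
  \<open>i\<close> have the same entry there: one composed with the inverse of the other is good and
  preserves line \<open>j\<close>. So a coordinate chosen on one line of each orbit can be
  transported along the orbit.\<close>

lemma ex_invariant_vector:
  assumes HG: "H \<subseteq> G" and one: "1\<^sub>m N \<in> H" and mult: "\<And>A B. A \<in> H \<Longrightarrow> B \<in> H \<Longrightarrow> A * B \<in> H"
    and good: "\<And>A. A \<in> H \<Longrightarrow> good A"
  obtains c where "\<And>i. i < N \<Longrightarrow> c i \<noteq> 0"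
    and "\<And>A i j. A \<in> H \<Longrightarrow> i < N \<Longrightarrow> j < N \<Longrightarrow> A $$ (i, j) \<noteq> 0 \<Longrightarrow> A $$ (i, j) * c j = c i"
proof -
  have pow: "A ^\<^sub>m s \<in> H" if "A \<in> H" for A s
  proof (induction s)
    case 0
    show ?case using carrier_matD(1)[OF G_carrier, of A] that HG one by auto
  qed (simp add: that mult)
  \<comment> \<open>Closure under products yields inverses because all elements have finite
    order.\<close>
  have inverse: "\<exists>B\<in>H. B * A = 1\<^sub>m N" if A: "A \<in> H" for A
  proof -
    obtain r where r: "r > 0" "A ^\<^sub>m r = 1\<^sub>m N" using finite_order A HG by blast
    then obtain s where "r = Suc s" by (cases r) auto
    with r have "A ^\<^sub>m s * A = 1\<^sub>m N" by simp
    then show ?thesis using pow[OF A] by blast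
  qed
  have comp: "(A * B) $$ (i, l) = A $$ (i, j) * B $$ (j, l)"
    if "A \<in> H" "B \<in> H" "i < N" "j < N" "l < N" "B $$ (j, l) \<noteq> 0" for A B i j l
    using that HG by (intro mult_index) (auto intro: G_carrier)
  define R where "R i j \<longleftrightarrow> (\<exists>A\<in>H. A $$ (i, j) \<noteq> 0)" for i j
  have R_refl: "R i i" if "i < N" for i
    unfolding R_def by (rule bexI[OF _ one]) (simp add: that)
  have R_trans: "R i l" if "R i j" "R j l" "i < N" "j < N" "l < N" for i j l
    using that comp unfolding R_def by (metis mult mult_eq_0_iff)
  have inv_entry: "\<exists>B\<in>H. B $$ (j, i) * A $$ (i, j) = 1"
    if A: "A \<in> H" "A $$ (i, j) \<noteq> 0" and ij: "i < N" "j < N" for A i j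
  proof -
    obtain B where B: "B \<in> H" "B * A = 1\<^sub>m N" using inverse[OF A(1)] by blast
    have "B $$ (j, i) * A $$ (i, j) = 1"
      using comp[OF B(1) A(1) ij(2,1,2) A(2)] ij(2) unfolding B(2) by simp
    with B(1) show ?thesis by blast
  qed
  have R_sym: "R j i" if "R i j" "i < N" "j < N" for i j
    using that inv_entry unfolding R_def by (metis mult_zero_left zero_neq_one)
  have unique: "A $$ (i, j) = B $$ (i, j)"
    if AB: "A \<in> H" "B \<in> H" "i < N" "j < N" "A $$ (i, j) \<noteq> 0" "B $$ (i, j) \<noteq> 0" for A B i j
  proof -
    obtain A' where A': "A' \<in> H" "A' $$ (j, i) * A $$ (i, j) = 1"
      using inv_entry AB by blast
    have e: "(A' * B) $$ (j, j) = A' $$ (j, i) * B $$ (i, j)"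
      by (rule comp) (use A' AB in auto)
    also have "\<dots> \<noteq> 0" using A' AB by auto
    finally have "(A' * B) $$ (j, j) = 1"
      by (intro good_diag good mult) (use A' AB in auto)
    then show ?thesis using e A'(2) by (metis mult_cancel_left mult_zero_left zero_neq_one)
  qed
  \<comment> \<open>The least index is a representative that depends on the orbit alone.\<close>
  define rep where "rep i = (LEAST j. j < N \<and> R i j)" for i
  have rep: "rep i < N" "R i (rep i)" if "i < N" for i
    using LeastI[of "\<lambda>j. j < N \<and> R i j" i] that R_refl unfolding rep_def by auto
  have rep_eq: "rep i = rep j" if "R i j" "i < N" "j < N" for i j
  proof -
    have "(\<lambda>l. l < N \<and> R i l) = (\<lambda>l. l < N \<and> R j l)"
      using that R_trans R_sym by blast
    then show ?thesis unfolding rep_def by simp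
  qed
  \<comment> \<open>The coordinate at \<open>i\<close> is the entry by which \<open>H\<close>
    carries the representative line to line \<open>i\<close>. The bound on \<open>i\<close> stands
    inside so that choice yields a total function.\<close>
  have "\<forall>i. \<exists>z. i < N \<longrightarrow> z \<noteq> 0 \<and> (\<exists>A\<in>H. A $$ (i, rep i) = z)"
    using rep(2) unfolding R_def by blast
  then obtain c where c: "c i \<noteq> 0" "\<exists>A\<in>H. A $$ (i, rep i) = c i" if "i < N" for i
    by metis
  show ?thesis
  proof (rule that[of c])
    show "c i \<noteq> 0" if "i < N" for i by (rule c(1)[OF that])
    fix A i j assume A: "A \<in> H" "i < N" "j < N" "A $$ (i, j) \<noteq> 0"
    obtain B where B: "B \<in> H" "B $$ (j, rep j) = c j" using c(2)[OF A(3)] by blast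
    obtain B' where B': "B' \<in> H" "B' $$ (i, rep i) = c i" using c(2)[OF A(2)] by blast
    have req: "rep i = rep j" using A by (intro rep_eq) (auto simp: R_def)
    have e: "(A * B) $$ (i, rep j) = A $$ (i, j) * B $$ (j, rep j)"
      by (rule comp) (use A B rep c(1) in auto)
    have "(A * B) $$ (i, rep j) = B' $$ (i, rep j)"
      by (rule unique) (use A B B' rep(1) c(1) mult req in \<open>auto simp: e\<close>)
    then show "A $$ (i, j) * c j = c i" using e B(2) B'(2) req by simp
  qed
qed

lemma permutableI:
  assumes HG: "H \<subseteq> G" and one: "1\<^sub>m N \<in> H" and mult: "\<And>A B. A \<in> H \<Longrightarrow> B \<in> H \<Longrightarrow> A * B \<in> H"
    and good: "\<And>A. A \<in> H \<Longrightarrow> good A" and cover: "\<And>A. A \<in> G \<Longrightarrow> \<exists>B\<in>H. \<exists>j. A = B * diag_rot N j"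
  shows permutable
proof -
  obtain c where c0: "\<And>i. i < N \<Longrightarrow> c i \<noteq> 0"
    and c: "\<And>A i j. A \<in> H \<Longrightarrow> i < N \<Longrightarrow> j < N \<Longrightarrow> A $$ (i, j) \<noteq> 0 \<Longrightarrow> A $$ (i, j) * c j = c i"
    using ex_invariant_vector[OF HG one mult good] by blast
  \<comment> \<open>Column \<open>m\<close> of \<open>T\<close> is the \<open>m\<close>-th power of
    the cycle applied to the invariant vector. As the coordinates are nonzero, \<open>T\<close> is a
    Fourier matrix with rescaled rows, and \<open>T'\<close> is its inverse.\<close>
  define T where "T = mat N N (\<lambda>(i, m). c i * rot N (int i * int m))"
  define T' where "T' = mat N N (\<lambda>(m, i). rot N (- (int i * int m)) / (of_nat N * c i))"
  have T: "T \<in> carrier_mat N N" and T': "T' \<in> carrier_mat N N" by (simp_all add: T_def T'_def)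
  have TT': "T * T' = 1\<^sub>m N"
  proof (rule eq_matI)
    show "dim_row (T * T') = dim_row (1\<^sub>m N)" "dim_col (T * T') = dim_col (1\<^sub>m N)"
      using T T' by auto
    fix i j assume "i < dim_row (1\<^sub>m N :: complex mat)" "j < dim_col (1\<^sub>m N :: complex mat)"
    then have ij: "i < N" "j < N" by auto
    have "(T * T') $$ (i, j) = (\<Sum>m<N. T $$ (i, m) * T' $$ (m, j))"
      by (rule index_mat_mult_sum[OF T T' ij])
    also have "\<dots> = (\<Sum>m<N. c i / (of_nat N * c j) * rot N ((int i - int j) * int m))"
      using ij by (intro sum.cong) (auto simp: T_def T'_def left_diff_distrib rot_add[of N "_ * _" "- _", simplified])
    also have "\<dots> = c i / (of_nat N * c j) * (\<Sum>m<N. rot N ((int i - int j) * int m))"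
      by (simp add: sum_distrib_left)
    also have "\<dots> = (if i = j then 1 else 0)"
      using N_pos c0 ij index_cong_eq[OF ij] by (auto simp: sum_rot[OF N_pos] cong_iff_dvd_diff)
    finally show "(T * T') $$ (i, j) = 1\<^sub>m N $$ (i, j)" using ij by simp
  qed
  then have T'T: "T' * T = 1\<^sub>m N" by (rule mat_mult_left_right_inverse[OF T T'])
  have "is_permutation_matrix N (T' * A * T)" if A: "A \<in> G" for A
  proof -
    obtain B j where B: "B \<in> H" "A = B * diag_rot N j" using cover[OF A] by blast
    then have BG: "B \<in> G" using HG by blast
    obtain k where k: "over k B" using ex_over[OF BG] ..
    obtain k' where k': "[k * k' = 1] (mod int N)" using over_unit[OF k] ..
    \<comment> \<open>Moving \<open>B\<close> past the power \<open>m + j\<close> of the cycle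
      multiplies the exponent by \<open>k'\<close>, and \<open>B\<close> fixes the invariant vector;
      so column \<open>m\<close> goes to column \<open>k' * (m + j)\<close>. Outside the range,
      \<open>permutes\<close> asks for the identity.\<close>
    define \<sigma> where "\<sigma> m = (if m < N then nat ((k' * (int m + j)) mod int N) else m)" for m
    have \<sigma>: "\<sigma> m < N" "[int (\<sigma> m) = k' * (int m + j)] (mod int N)" if "m < N" for m
      using that N_pos by (simp_all add: \<sigma>_def nat_less_iff)
    have "\<sigma> permutes {0..<N}"
    proof (rule bij_imp_permutes)
      have "m = m'" if m: "m < N" "m' < N" "\<sigma> m = \<sigma> m'" for m m'
      proof -
        have "[k' * (int m + j) = k' * (int m' + j)] (mod int N)"
          using \<sigma>(2)[OF m(1)] \<sigma>(2)[OF m(2)] m(3) by (metis cong_sym cong_trans)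
        then have "[k * k' * (int m + j) = k * k' * (int m' + j)] (mod int N)"
          unfolding mult.assoc by (rule cong_scalar_left)
        then have "[1 * (int m + j) = 1 * (int m' + j)] (mod int N)"
          using cong_scalar_right[OF k'] by (meson cong_sym cong_trans)
        then show ?thesis using index_cong_eq[OF m(1,2)] by (simp add: cong_add_rcancel)
      qed
      then have "inj_on \<sigma> {0..<N}" by (intro inj_onI) auto
      moreover have "\<sigma> ` {0..<N} \<subseteq> {0..<N}" using \<sigma>(1) by auto
      ultimately show "bij_betw \<sigma> {0..<N} {0..<N}"
        by (simp add: bij_betw_def endo_inj_surj)
      show "\<sigma> x = x" if "x \<notin> {0..<N}" for x using that by (simp add: \<sigma>_def)
    qed
    have "A * T = T * perm_mat N \<sigma>"
    proof (rule eq_matI)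
      show "dim_row (A * T) = dim_row (T * perm_mat N \<sigma>)" "dim_col (A * T) = dim_col (T * perm_mat N \<sigma>)"
        using G_carrier[OF A] T by auto
      fix i m assume "i < dim_row (T * perm_mat N \<sigma>)" "m < dim_col (T * perm_mat N \<sigma>)"
      then have im: "i < N" "m < N" using T by auto
      obtain l where l: "l < N" "B $$ (i, l) \<noteq> 0" using row_nonzero[OF BG im(1)] by blast
      have kl: "[int i = k * int l] (mod int N)" by (rule over_nonzero[OF k im(1) l])
      have AB: "A $$ (i, a) = B $$ (i, a) * rot N (j * int a)" if "a < N" for a
        unfolding B(2) by (rule mult_diag_rot_index[OF G_carrier[OF BG] im(1) that])
      \<comment> \<open>Since \<open>k\<close> is invertible modulo \<open>N\<close>, row
        \<open>i\<close> has its only nonzero entry in column \<open>l\<close>.\<close>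
      have "A $$ (i, a) = 0" if "a < N" "a \<noteq> l" for a
      proof (rule ccontr)
        assume "A $$ (i, a) \<noteq> 0"
        then have "[int i = k * int a] (mod int N)"
          using over_nonzero[OF k im(1) that(1)] AB[OF that(1)] by auto
        then have "[k * int l = k * int a] (mod int N)" using kl cong_sym cong_trans by blast
        then have "[k' * (k * int l) = k' * (k * int a)] (mod int N)" by (rule cong_scalar_left)
        then have "[k * k' * int l = k * k' * int a] (mod int N)" by (simp add: ac_simps)
        then have "[1 * int l = 1 * int a] (mod int N)"
          using cong_scalar_right[OF k'] by (meson cong_sym cong_trans)
        then show False using index_cong_eq[OF l(1) that(1)] that(2) by simp
      qed
      then have "(A * T) $$ (i, m) = (\<Sum>a\<in>{l}. A $$ (i, a) * T $$ (a, m))"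
        unfolding index_mat_mult_sum[OF G_carrier[OF A] T im] using l(1)
        by (intro sum.mono_neutral_right) auto
      also have "\<dots> = B $$ (i, l) * c l * rot N (int l * (int m + j))"
        using l(1) im(2) by (simp add: AB T_def rot_add distrib_left ac_simps)
      also have "\<dots> = c i * rot N (int l * (int m + j))"
        using c[OF B(1) im(1) l] by simp
      also have "rot N (int l * (int m + j)) = rot N (int i * int (\<sigma> m))"
      proof -
        have "[int i * int (\<sigma> m) = k * int l * (k' * (int m + j))] (mod int N)"
          by (rule cong_mult[OF kl \<sigma>(2)[OF im(2)]])
        moreover have "[k * k' * (int l * (int m + j)) = 1 * (int l * (int m + j))] (mod int N)"
          by (rule cong_scalar_right[OF k'])
        ultimately have "[int i * int (\<sigma> m) = int l * (int m + j)] (mod int N)"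
          using cong_trans by (simp add: ac_simps) blast
        then show ?thesis by (simp add: rot_eq_iff[OF N_pos] cong_sym)
      qed
      also have "c i * rot N (int i * int (\<sigma> m)) = (T * perm_mat N \<sigma>) $$ (i, m)"
        unfolding mult_perm_mat_index[where \<tau> = \<sigma>, OF T \<sigma>(1)[OF im(2)] im] using im \<sigma>(1) by (simp add: T_def)
      finally show "(A * T) $$ (i, m) = (T * perm_mat N \<sigma>) $$ (i, m)" .
    qed
    have "T' * A * T = T' * (A * T)" by (rule assoc_mult_mat[OF T' G_carrier[OF A] T])
    also have "\<dots> = T' * (T * perm_mat N \<sigma>)" by (simp only: \<open>A * T = T * perm_mat N \<sigma>\<close>)
    also have "\<dots> = T' * T * perm_mat N \<sigma>" by (rule assoc_mult_mat[OF T' T perm_mat_carrier, symmetric])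
    also have "\<dots> = perm_mat N \<sigma>" unfolding T'T by (rule left_mult_one_mat[OF perm_mat_carrier])
    finally show ?thesis using \<open>\<sigma> permutes {0..<N}\<close> unfolding is_permutation_matrix_def by blast
  qed
  then show ?thesis unfolding permutable_def using T T' TT' T'T by blast
qed

section \<open>Groups whose exponents are powers of one integer\<close>

lemma pow_mult:
  assumes "A \<in> G"
  shows "A ^\<^sub>m s * A ^\<^sub>m t = A ^\<^sub>m (s + t)"
proof (induction t)
  case 0
  show ?case using right_mult_one_mat[OF G_carrier[OF G_pow[OF assms, of s]]]
      carrier_matD(1)[OF G_carrier[OF assms]] by simp
next
  case (Suc t)
  then show ?case by (simp add: G_assoc[OF G_pow G_pow, OF assms assms assms, symmetric])
qed

lemma over_one: "over 1 (1\<^sub>m N)"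
  using over_diag_rot[of 0] by simp

lemma ex_good_over:
  assumes "over k A"
  obtains B where "over k B" "good B"
  using ex_good[OF over_in_G[OF assms]] over_mult_diag_rot[OF assms] by blast

lemma permutable_cyclic:
  assumes "over b B" and gen: "\<And>A. A \<in> G \<Longrightarrow> \<exists>k t. over k A \<and> [b ^ t = k] (mod int N)"
  shows permutable
proof -
  obtain X where X: "over b X" "good X" by (rule ex_good_over[OF assms(1)])
  have XG: "X \<in> G" by (rule over_in_G[OF X(1)])
  show ?thesis
  proof (rule permutableI)
    show "range (\<lambda>t. X ^\<^sub>m t) \<subseteq> G" using G_pow[OF XG] by auto
    have "X ^\<^sub>m 0 = 1\<^sub>m N" using G_carrier[OF XG] by simp
    then show "1\<^sub>m N \<in> range (\<lambda>t. X ^\<^sub>m t)" by (metis rangeI)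
    show "A * B \<in> range (\<lambda>t. X ^\<^sub>m t)" if "A \<in> range (\<lambda>t. X ^\<^sub>m t)" "B \<in> range (\<lambda>t. X ^\<^sub>m t)" for A B
      using that pow_mult[OF XG] by auto
    show "good A" if "A \<in> range (\<lambda>t. X ^\<^sub>m t)" for A using that good_pow[OF X(2)] by auto
    show "\<exists>B\<in>range (\<lambda>t. X ^\<^sub>m t). \<exists>j. A = B * diag_rot N j" if A: "A \<in> G" for A
    proof -
      obtain k t where kt: "over k A" "[b ^ t = k] (mod int N)" using gen[OF A] by blast
      have "over k (X ^\<^sub>m t)" by (rule over_cong[OF over_pow[OF X(1)] kt(2)])
      then obtain j where "A = X ^\<^sub>m t * diag_rot N j" using over_same kt(1) by blast
      then show ?thesis by blast
    qed
  qed
qed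

text \<open>Index \<open>0\<close> is preserved for every exponent and all powers of the cycle have
  entry \<open>1\<close> there, so a good translate of \<open>A\<close> has the same entry at
  \<open>(0, 0)\<close> as \<open>A\<close>.\<close>

lemma diag_0:
  assumes "A \<in> G"
  shows "A $$ (0, 0) = 1"
proof -
  obtain k where k: "over k A" using ex_over[OF assms] ..
  obtain m where m: "good (A * diag_rot N m)" by (rule ex_good[OF assms])
  have e: "(A * diag_rot N m) $$ (0, 0) = A $$ (0, 0)"
    using mult_diag_rot_index[OF G_carrier[OF assms] N_pos N_pos, of m] by simp
  have "A $$ (0, 0) \<noteq> 0" using diag_nonzero_iff[OF k N_pos] by simp
  then show ?thesis using good_diag[OF m N_pos] unfolding e by blast
qed

end

section \<open>Units modulo powers of two\<close>

text \<open>Each squaring raises the valuation of the distance from \<open>1\<close> by one: the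
  extra summand \<open>2 ^ w * u'\<^sup>2\<close> is even because \<open>v \<ge> 2\<close> gives
  \<open>w \<ge> 1\<close>.\<close>

lemma two_adic_power:
  fixes u :: int
  assumes "odd u" "v \<ge> 2"
  shows "\<exists>u'. odd u' \<and> (1 + 2 ^ v * u) ^ 2 ^ j = 1 + 2 ^ (v + j) * u'"
proof (induction j)
  case 0
  show ?case using assms(1) by auto
next
  case (Suc j)
  then obtain u' where u': "odd u'" "(1 + 2 ^ v * u) ^ 2 ^ j = 1 + 2 ^ (v + j) * u'" by blast
  define w where "w = v + j - 1"
  have w: "v + j = Suc w" "v + Suc j = Suc (Suc w)" "w \<ge> 1" using assms(2) by (auto simp: w_def)
  have "(1 + 2 ^ v * u) ^ 2 ^ Suc j = (1 + 2 ^ (v + j) * u')\<^sup>2"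
    by (simp add: power_mult u'(2) flip: power_mult[of _ _ 2] mult.commute[of _ 2])
  also have "\<dots> = 1 + 2 ^ (v + Suc j) * (u' + 2 ^ w * u'\<^sup>2)"
    unfolding w(1,2) by (simp add: power2_eq_square algebra_simps)
  finally have "(1 + 2 ^ v * u) ^ 2 ^ Suc j = 1 + 2 ^ (v + Suc j) * (u' + 2 ^ w * u'\<^sup>2)" .
  moreover have "odd (u' + 2 ^ w * u'\<^sup>2)" using u'(1) w(3) by simp
  ultimately show ?case by blast
qed

text \<open>Solutions are lifted from modulus \<open>2 ^ n\<close> to its double: the factor
  \<open>l ^ 2 ^ j\<close> is \<open>1\<close> plus an odd multiple of \<open>2 ^ n\<close>, so it
  flips the next binary digit and keeps the lower ones.\<close>

lemma two_adic_generator: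
  fixes u k :: int
  assumes "odd u" "v \<ge> 2" "[k = 1] (mod 2 ^ v)"
  shows "\<exists>t. [(1 + 2 ^ v * u) ^ t = k] (mod 2 ^ n)"
proof (induction n)
  case 0
  show ?case by simp
next
  case (Suc n)
  define l where "l = 1 + 2 ^ v * u"
  obtain t where t: "[l ^ t = k] (mod 2 ^ n)" using Suc by (auto simp: l_def)
  show ?case
  proof (cases "n < v")
    case True
    \<comment> \<open>Up to modulus \<open>2 ^ v\<close> the hypothesis on \<open>k\<close> makes
      the exponent \<open>0\<close> suffice.\<close>
    then have "(2 :: int) ^ Suc n dvd 2 ^ v" by (intro le_imp_power_dvd) simp
    then have "[k = 1] (mod 2 ^ Suc n)" using assms(3) cong_dvd_modulus by blast
    then have "[(1 + 2 ^ v * u) ^ 0 = k] (mod 2 ^ Suc n)" by (simp add: cong_sym_eq)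
    then show ?thesis by blast
  next
    case False
    then obtain j where n: "n = v + j" by (metis le_add_diff_inverse not_less)
    obtain u' where u': "odd u'" "l ^ 2 ^ j = 1 + 2 ^ n * u'"
      using two_adic_power[OF assms(1,2), of j] by (auto simp: l_def n)
    obtain q where q: "l ^ t - k = 2 ^ n * q" using t by (auto simp: cong_iff_dvd_diff)
    have "odd l" using assms(2) by (simp add: l_def)
    show ?thesis
    proof (cases "even q")
      case True
      then have "2 ^ Suc n dvd l ^ t - k" unfolding q by (simp add: mult_dvd_mono mult.commute)
      then show ?thesis unfolding cong_iff_dvd_diff l_def by blast
    next
      case False
      have "l ^ (t + 2 ^ j) - k = 2 ^ n * (q + u' * l ^ t)"
        using q by (simp add: power_add u'(2) algebra_simps)
      moreover have "even (q + u' * l ^ t)" using False u'(1) \<open>odd l\<close> by simp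
      ultimately have "2 ^ Suc n dvd l ^ (t + 2 ^ j) - k" by (simp add: mult_dvd_mono mult.commute)
      then show ?thesis unfolding cong_iff_dvd_diff l_def by blast
    qed
  qed
qed

lemma odd_decomposition:
  fixes a :: int
  assumes "a \<noteq> 0"
  obtains v u where "a = 2 ^ v * u" "odd u"
proof -
  have "\<not> is_unit (2 :: int)" by simp
  then obtain u where "a = 2 ^ multiplicity 2 a * u" "odd u"
    using multiplicity_decompose'[OF assms] by metis
  then show ?thesis by (rule that)
qed

text \<open>Among the members of \<open>K\<close> not congruent to \<open>1\<close>, one with the
  least 2-adic valuation \<open>v\<close> of \<open>k - 1\<close> is taken. By
  \<open>two_adic_generator\<close> its powers then cover \<open>K\<close> modulo
  \<open>2 ^ n\<close>; the hypothesis modulo \<open>4\<close> gives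
  \<open>v \<ge> 2\<close>.\<close>

lemma ex_two_adic_generator:
  fixes K :: "int set"
  assumes K: "\<forall>k\<in>K. [k = 1] (mod 4)"
  obtains "\<And>k. k \<in> K \<Longrightarrow> [k = 1] (mod 2 ^ n)"
  | v u where "odd u" "2 \<le> v" "v < n" "1 + 2 ^ v * u \<in> K" "\<And>k. k \<in> K \<Longrightarrow> [k = 1] (mod 2 ^ v)"
proof (cases "\<forall>k\<in>K. [k = 1] (mod 2 ^ n)")
  case True
  then show ?thesis using that(1) by blast
next
  case False
  define P where "P v \<longleftrightarrow> (\<exists>u. odd u \<and> v < n \<and> 1 + 2 ^ v * u \<in> K)" for v
  have P: "P w" if "1 + 2 ^ w * u \<in> K" "odd u" "w < n" for w u using that by (auto simp: P_def)
  from False obtain k where k: "k \<in> K" "\<not> [k = 1] (mod 2 ^ n)" by blast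
  then have "k - 1 \<noteq> 0" by auto
  then obtain w u where wu: "k - 1 = 2 ^ w * u" "odd u" by (rule odd_decomposition)
  have "w < n"
  proof (rule ccontr)
    assume "\<not> w < n"
    then have "(2 :: int) ^ n dvd 2 ^ w" by (intro le_imp_power_dvd) simp
    then have "2 ^ n dvd k - 1" unfolding wu(1) by simp
    then show False using k(2) by (simp add: cong_iff_dvd_diff)
  qed
  then have "P w" using P[of w u] wu k(1) by (metis add.commute diff_add_cancel)
  define v where "v = (LEAST v. P v)"
  have "P v" unfolding v_def using \<open>P w\<close> by (rule LeastI)
  then obtain u' where u': "odd u'" "v < n" "1 + 2 ^ v * u' \<in> K" by (auto simp: P_def)
  have "v \<ge> 2"
  proof (rule ccontr)
    assume "\<not> v \<ge> 2"
    then have "v = 0 \<or> v = 1" by auto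
    moreover have "4 dvd 2 ^ v * u'" using K u'(3) by (force simp: cong_iff_dvd_diff)
    ultimately have "2 dvd u'" by auto
    then show False using u'(1) by simp
  qed
  moreover have "[k = 1] (mod 2 ^ v)" if k: "k \<in> K" for k
  proof (cases "k = 1")
    case False
    then have "k - 1 \<noteq> 0" by simp
    then obtain w u where wu: "k - 1 = 2 ^ w * u" "odd u" by (rule odd_decomposition)
    have "v \<le> w"
    proof (rule ccontr)
      assume "\<not> v \<le> w"
      then have "P w" using P[of w u] wu k u'(2) by (metis add.commute diff_add_cancel less_trans not_le)
      then show False using \<open>\<not> v \<le> w\<close> not_less_Least[of w P] by (simp add: v_def)
    qed
    then have "(2 :: int) ^ v dvd 2 ^ w" by (rule le_imp_power_dvd)
    then have "2 ^ v dvd k - 1" unfolding wu(1) by simp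
    then show ?thesis by (simp add: cong_iff_dvd_diff)
  qed simp
  ultimately show ?thesis using that(2) u' by blast
qed

lemma cong_4_odd: "odd (k :: int) \<Longrightarrow> [k = 1] (mod 4) \<or> [k = 3] (mod 4)"
  by (simp add: cong_def) presburger

section \<open>Dimension a power of two: exponents generated by \<open>l\<close> and
  \<open>-1\<close>, and the case distinction\<close>

context monomial_group
begin

text \<open>Here \<open>A\<close> lies over \<open>l\<close> and \<open>B\<close> over \<open>-1\<close>. After multiplying \<open>B\<close> by a power \<open>C\<^sup>x\<close> the
  two commute, and \<open>B C\<^sup>x\<close> is still good if \<open>x\<close> is even. If \<open>x\<close> is odd then
  \<open>A B C\<^sup>x C\<close> is good, but its square is not.\<close>

lemma permutable_noncyclic:
  fixes u :: int
  assumes N: "N = 2 ^ n" and l: "l = 1 + 2 ^ v * u" "odd u" "2 \<le> v" "v < n"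
    and A0: "over l A0" and B0: "over (- 1) B0"
    and cover: "\<And>X. X \<in> G \<Longrightarrow> \<exists>k t. over k X \<and> ([l ^ t = k] (mod int N) \<or> [- (l ^ t) = k] (mod int N))"
  shows permutable
proof -
  obtain A where A: "over l A" "good A" by (rule ex_good_over[OF A0])
  obtain B where B: "over (- 1) B" "good B" by (rule ex_good_over[OF B0])
  have AG: "A \<in> G" and BG: "B \<in> G" using A B by (simp_all add: good_in_G)
  note G = AG BG G_diag_rot G_mult
  have right_one: "X * 1\<^sub>m N = X" if "X \<in> G" for X
    using that G_carrier right_mult_one_mat by blast
  have diag_diag: "X * diag_rot N a * diag_rot N b = X * diag_rot N (a + b)" if "X \<in> G" for X a b
    using that by (simp add: G_assoc G_diag_rot diag_rot_mult)
  have BB: "B * B = 1\<^sub>m N"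
  proof (rule good_over_1)
    show "over 1 (B * B)" using over_mult[OF B(1) B(1)] by simp
    have "B ^\<^sub>m 2 = B * B" using G_carrier[OF BG] by (simp add: numeral_2_eq_2)
    then show "good (B * B)" using good_pow[OF B(2), of 2] by simp
  qed
  have "over (- 1 * l * - 1) (B * A * B)" by (intro over_mult A B)
  then have BAB: "over l (B * A * B)" by simp
  obtain j where j: "B * A * B = A * diag_rot N j" by (rule over_same[OF A(1) BAB])
  \<comment> \<open>As \<open>B\<close> is its own inverse, \<open>B * A * B\<close> is a conjugate
    of \<open>A\<close> and has the same nonzero trace.\<close>
  have "mat_trace (B * A * B) = mat_trace (B * (B * A))"
    using G by (intro mat_trace_comm) (auto intro: G_carrier)
  also have "B * (B * A) = A"
    using BB G left_mult_one_mat[OF G_carrier[OF AG]] by (simp flip: G_assoc)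
  finally have "good (A * diag_rot N j)"
    using A(2) G by (simp add: good_def flip: j)
  then obtain x where x: "[j = (l - 1) * x] (mod int N)" by (rule good_shift[OF A(2,1)])
  \<comment> \<open>The shift by \<open>x\<close> compensates the shift \<open>j\<close> caused by
    conjugation with \<open>B\<close>, so that \<open>B'\<close> commutes with \<open>A\<close>; see
    \<open>comm\<close>.\<close>
  define B' where "B' = B * diag_rot N x"
  have B': "over (- 1) B'" "B' \<in> G"
    using over_mult_diag_rot[OF B(1)] G by (simp_all add: B'_def)
  have BA: "B * A = A * B * diag_rot N ((1 - l) * x)"
  proof -
    have "B * A = B * A * (B * B)" using G by (simp add: BB right_one)
    also have "\<dots> = A * diag_rot N j * B" using G by (simp flip: j add: G_assoc)
    also have "\<dots> = A * (B * diag_rot N (- j))"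
      using diag_rot_commute[OF B(1), of j] G by (simp add: G_assoc)
    also have "diag_rot N (- j) = diag_rot N ((1 - l) * x)"
      using x by (intro diag_rot_cong) (metis cong_minus_minus_iff minus_diff_eq minus_mult_left)
    finally show ?thesis using G by (simp add: G_assoc)
  qed
  have comm: "B' * A = A * B'"
  proof -
    have "B' * A = B * A * diag_rot N (l * x)"
      using diag_rot_commute[OF A(1), of x] G by (simp add: B'_def G_assoc)
    also have "\<dots> = A * B * diag_rot N x"
      using G by (simp add: BA diag_diag algebra_simps)
    finally show ?thesis using G by (simp add: B'_def G_assoc)
  qed
  have BB': "B' * B' = 1\<^sub>m N"
  proof -
    have "B' * B' = B * (diag_rot N x * B) * diag_rot N x" using G by (simp add: B'_def G_assoc)
    also have "\<dots> = B * B * diag_rot N (- x) * diag_rot N x"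
      using diag_rot_commute[OF B(1), of x] G by (simp add: G_assoc)
    also have "\<dots> = B * B" using G by (simp add: diag_diag right_one)
    finally show ?thesis by (simp only: BB)
  qed
  \<comment> \<open>The index \<open>N / 2\<close> is preserved for every odd exponent, and a power
    of the cycle has entry \<open>1\<close> or \<open>-1\<close> there according to the parity of
    the power.\<close>
  define h where "h = (2 :: nat) ^ (n - 1)"
  have "n \<ge> 3" using l by simp
  then obtain n' where n': "n = Suc n'" "n' \<ge> 2" by (cases n) auto
  have h: "h < N" "int N = 2 * int h" using n' by (auto simp: h_def N)
  have fixed_h: "h \<in> fixed_idx k" if k: "odd k" for k
  proof -
    obtain q where "k = 2 * q + 1" using k by (elim oddE)
    then have "k * int h - int h = int N * q" using h(2) by (simp add: algebra_simps)
    then have "[k * int h = int h] (mod int N)" by (simp add: cong_iff_dvd_diff)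
    then show ?thesis using h(1) by (simp add: fixed_idx_def)
  qed
  have good_hh: "X $$ (h, h) = 1" if "good X" "over k X" "odd k" for X k
    using good_diag[OF that(1) h(1)] diag_nonzero_iff[OF that(2) h(1)] fixed_h[OF that(3)] by blast
  \<comment> \<open>Here \<open>k - 1\<close> is twice an odd number, so only \<open>0\<close> and
    \<open>h\<close> are preserved. The entry at \<open>0\<close> is always \<open>1\<close>, and
    the entry at \<open>h\<close> decides.\<close>
  have good_3: "good X" if X: "over k X" "[k = 3] (mod 4)" "X $$ (h, h) = 1" for X k
    unfolding good_iff[OF over_in_G[OF X(1)]]
  proof (intro allI impI)
    fix i assume i: "i < N" "X $$ (i, i) \<noteq> 0"
    then have "[k * int i = int i] (mod int N)"
      using diag_nonzero_iff[OF X(1)] by (auto simp: fixed_idx_def)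
    then have d: "2 * int h dvd (k - 1) * int i"
      by (simp add: cong_iff_dvd_diff h(2) left_diff_distrib)
    obtain q where "k - 3 = 4 * q" using X(2) by (auto simp: cong_iff_dvd_diff)
    then have k: "k - 1 = 2 * (2 * q + 1)" by simp
    from d have "int h dvd (2 * q + 1) * int i"
      unfolding k mult.assoc by (simp only: dvd_mult_cancel_left) simp
    moreover have "coprime (int h) (2 * q + 1)" by (simp add: h_def coprime_power_left_iff)
    ultimately have "int h dvd int i" by (simp add: coprime_dvd_mult_right_iff)
    then have "h dvd i" by simp
    then obtain a where a: "i = h * a" by (elim dvdE)
    have "N = 2 * h" using h(2) by linarith
    then have "h * a < h * 2" using i(1) a by simp
    then have "a < 2" by simp
    then have "i = 0 \<or> i = h" using a by (auto simp: less_2_cases_iff)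
    then show "X $$ (i, i) = 1" using X(3) diag_0[OF over_in_G[OF X(1)]] by auto
  qed
  have hh_mult: "(X * Y) $$ (h, h) = X $$ (h, h) * Y $$ (h, h)"
    if "X \<in> G" "over k Y" "odd k" for X Y k
    using mult_index[OF G_carrier[OF that(1)] over_in_G[OF that(2)] h(1) h(1) h(1)]
      diag_nonzero_iff[OF that(2) h(1)] fixed_h[OF that(3)] by blast
  have hh_diag: "diag_rot N a $$ (h, h) = (if even a then 1 else - 1)" for a
  proof -
    have "rot N (int h) * rot N (int h) = 1" "rot N (int h) \<noteq> 1"
      using h N_pos by (auto simp: rot_eq_1_iff[OF N_pos] zdvd_not_zless simp flip: rot_add)
    then have *: "rot N (int h) = - 1" by (metis square_eq_1_iff)
    have "rot N (a * int h) = (if even a then 1 else - 1)"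
    proof (cases "even a")
      case True
      then show ?thesis using h(2) by (auto simp: rot_eq_1_iff[OF N_pos] elim!: evenE)
    next
      case False
      then obtain q where "a = 2 * q + 1" by (elim oddE)
      then have "rot N (a * int h) = rot N (int N * q + int h)" using h(2) by (simp add: algebra_simps)
      also have "\<dots> = rot N (int h)" unfolding rot_add using N_pos by (simp add: rot_eq_1_iff)
      finally show ?thesis using * False by simp
    qed
    then show ?thesis using h(1) by simp
  qed
  have odd_l: "odd l" and l4: "[l = 1] (mod 4)"
  proof -
    have "(2 :: int) ^ 2 dvd 2 ^ v" using l(3) by (rule le_imp_power_dvd)
    then have d: "4 dvd l - 1" using l(1) by simp
    then show "[l = 1] (mod 4)" by (simp add: cong_iff_dvd_diff)
    have "2 dvd l - 1" using d by (rule dvd_trans[rotated]) simp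
    then show "odd l" by presburger
  qed
  have B'_hh: "B' $$ (h, h) = (if even x then 1 else - 1)"
    unfolding B'_def using hh_mult[OF BG over_diag_rot] good_hh[OF B(2,1)] by (simp add: hh_diag)
  show ?thesis
  proof (cases "even x")
    case True
    \<comment> \<open>The commutative group generated by \<open>A\<close> and the involution
      \<open>B'\<close>. Each \<open>A ^\<^sub>m s * B'\<close> is over an exponent congruent to
      \<open>3\<close> modulo \<open>4\<close>, so \<open>good_3\<close> tests it at
      \<open>h\<close>.\<close>
    define H where "H = {A ^\<^sub>m s | s. True} \<union> {A ^\<^sub>m s * B' | s. True}"
    have pow_comm: "B' * A ^\<^sub>m s = A ^\<^sub>m s * B'" for s
    proof (induction s)
      case 0
      show ?case using G_carrier[OF AG] G_carrier[OF B'(2)] by simp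
    next
      case (Suc s)
      have "B' * A ^\<^sub>m Suc s = B' * A ^\<^sub>m s * A" using B'(2) AG by (simp add: G_assoc G_pow)
      also have "\<dots> = A ^\<^sub>m s * (B' * A)" using B'(2) AG Suc by (simp add: G_assoc G_pow)
      also have "\<dots> = A ^\<^sub>m Suc s * B'" using B'(2) AG by (simp add: comm G_assoc G_pow)
      finally show ?case .
    qed
    have m1: "A ^\<^sub>m s * (A ^\<^sub>m t * B') = A ^\<^sub>m (s + t) * B'" for s t
      using B'(2) AG by (simp add: G_pow pow_mult flip: G_assoc)
    have m2: "A ^\<^sub>m s * B' * A ^\<^sub>m t = A ^\<^sub>m (s + t) * B'" for s t
      using B'(2) AG by (simp add: G_assoc G_pow pow_comm m1)
    have m3: "A ^\<^sub>m s * B' * (A ^\<^sub>m t * B') = A ^\<^sub>m (s + t)" for s t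
    proof -
      have "A ^\<^sub>m s * B' * (A ^\<^sub>m t * B') = A ^\<^sub>m (s + t) * B' * B'"
        using B'(2) AG by (simp add: G_pow G_mult m2 flip: G_assoc)
      also have "\<dots> = A ^\<^sub>m (s + t)" using B'(2) AG by (simp add: G_assoc G_pow BB' right_one)
      finally show ?thesis .
    qed
    show ?thesis
    proof (rule permutableI)
      show "H \<subseteq> G" using AG B'(2) by (auto simp: H_def G_pow G_mult)
      have "A ^\<^sub>m 0 = 1\<^sub>m N" using G_carrier[OF AG] by simp
      then show "1\<^sub>m N \<in> H" unfolding H_def by (metis (mono_tags, lifting) UnI1 mem_Collect_eq)
      show "X * Y \<in> H" if "X \<in> H" "Y \<in> H" for X Y
        using that unfolding H_def by (auto simp: pow_mult[OF AG] m1 m2 m3)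
      show "good X" if "X \<in> H" for X
      proof -
        have "good (A ^\<^sub>m s * B')" for s
        proof (rule good_3)
          show "over (l ^ s * - 1) (A ^\<^sub>m s * B')" by (intro over_mult over_pow A B')
          have "[l ^ s * - 1 = 1 ^ s * - 1] (mod 4)" by (intro cong_mult cong_pow l4 cong_refl)
          also have "[1 ^ s * - 1 = (3 :: int)] (mod 4)" by (simp add: cong_def)
          finally show "[l ^ s * - 1 = 3] (mod 4)" .
          show "(A ^\<^sub>m s * B') $$ (h, h) = 1"
            using hh_mult[OF G_pow[OF AG] B'(1), of s] good_hh[OF good_pow[OF A(2)] over_pow[OF A(1)], of s]
              odd_l True by (simp add: B'_hh)
        qed
        then show ?thesis using that good_pow[OF A(2)] by (auto simp: H_def)
      qed
      show "\<exists>Y\<in>H. \<exists>j. X = Y * diag_rot N j" if X: "X \<in> G" for X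
      proof -
        obtain k t where k: "over k X" "[l ^ t = k] (mod int N) \<or> [- (l ^ t) = k] (mod int N)"
          using cover[OF X] by blast
        have "over (l ^ t) (A ^\<^sub>m t)" "over (- (l ^ t)) (A ^\<^sub>m t * B')"
          using over_pow[OF A(1)] over_mult[OF over_pow[OF A(1), of t] B'(1)] by simp_all
        with k(2) have "over k (A ^\<^sub>m t) \<or> over k (A ^\<^sub>m t * B')" using over_cong by blast
        moreover have "A ^\<^sub>m t \<in> H" "A ^\<^sub>m t * B' \<in> H" by (auto simp: H_def)
        ultimately show ?thesis using over_same k(1) by metis
      qed
    qed
  next
    case False
    \<comment> \<open>For odd \<open>x\<close> the entry of \<open>B'\<close> at \<open>h\<close> is
      \<open>-1\<close>; the factor \<open>diag_rot N 1\<close> repairs the sign and makes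
      \<open>E\<close> good.\<close>
    define E where "E = A * B' * diag_rot N 1"
    have AB': "over (l * - 1) (A * B')" by (intro over_mult A B')
    have E: "over (l * - 1) E" unfolding E_def by (intro over_mult_diag_rot AB')
    have "good E"
    proof (rule good_3[OF E])
      have "[l * - 1 = 1 * - 1] (mod 4)" by (intro cong_mult l4 cong_refl)
      also have "[1 * - 1 = (3 :: int)] (mod 4)" by (simp add: cong_def)
      finally show "[l * - 1 = 3] (mod 4)" .
      show "E $$ (h, h) = 1"
        using hh_mult[OF over_in_G[OF AB'] over_diag_rot, of 1] hh_mult[OF AG B'(1)]
          good_hh[OF A(2,1) odd_l] False by (simp add: E_def B'_hh hh_diag)
    qed
    have AAg: "good (A * A)"
    proof -
      have "A ^\<^sub>m 2 = A * A" using G_carrier[OF AG] by (simp add: numeral_2_eq_2)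
      then show ?thesis using good_pow[OF A(2), of 2] by simp
    qed
    note G' = AG B'(2) G_diag_rot G_mult
    have "E * E = A * B' * (diag_rot N 1 * (A * B')) * diag_rot N 1"
      using G' by (simp add: E_def G_assoc)
    also have "\<dots> = A * (B' * A) * B' * diag_rot N (- l) * diag_rot N 1"
      using diag_rot_commute[OF AB', of 1] G' by (simp add: G_assoc)
    also have "\<dots> = A * A * (B' * B') * diag_rot N (1 - l)"
      using G' by (simp add: comm diag_rot_mult G_assoc)
    also have "\<dots> = A * A * diag_rot N (1 - l)" using G' by (simp add: BB' right_one)
    finally have EE: "E * E = A * A * diag_rot N (1 - l)" .
    have "E ^\<^sub>m 2 = E * E" using G_carrier[OF over_in_G[OF E]] by (simp add: numeral_2_eq_2)
    then have "good (A * A * diag_rot N (1 - l))" using good_pow[OF \<open>good E\<close>, of 2] EE by simp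
    \<comment> \<open>The square of \<open>E\<close> is the good matrix \<open>A * A\<close> shifted
      by \<open>1 - l\<close>. So \<open>1 - l\<close> is divisible by every common divisor of
      \<open>l * l - 1\<close> and \<open>N\<close>, in particular by \<open>2 ^ Suc v\<close>; but
      it is \<open>2 ^ v\<close> times an odd number.\<close>
    then obtain y where y: "[1 - l = (l * l - 1) * y] (mod int N)"
      by (rule good_shift[OF AAg over_mult[OF A(1) A(1)]])
    have "(2 :: int) ^ Suc v dvd 2 ^ n" using l(4) by (intro le_imp_power_dvd) simp
    then have d: "2 ^ Suc v dvd 1 - l - (l * l - 1) * y"
      using y by (simp add: N cong_iff_dvd_diff dvd_trans)
    obtain q where q: "l = 2 * q + 1" using odd_l by (elim oddE)
    have "l * l - 1 = (l - 1) * (l + 1)" by (simp add: algebra_simps)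
    also have "\<dots> = 2 ^ Suc v * (u * (q + 1))" using l(1) q by (simp add: algebra_simps)
    finally have "2 ^ Suc v dvd (l * l - 1) * y" by simp
    then have "2 ^ Suc v dvd 1 - l" using d dvd_diff_right_iff by (metis diff_add_cancel dvd_add_left_iff)
    then have "2 ^ v * 2 dvd 2 ^ v * u" using l(1) by (simp add: mult.commute)
    then have "2 dvd u" by simp
    then show ?thesis using l(2) by simp
  qed
qed

text \<open>The exponents congruent to \<open>1\<close> modulo \<open>4\<close> are powers of a
  single one. A further exponent \<open>b\<close> congruent to \<open>3\<close> either yields
  \<open>-1\<close> as an exponent, or its square generates all of \<open>K\<close> and then
  \<open>b\<close> generates everything.\<close>

theorem permutable_power_of_two:
  assumes N: "N = 2 ^ n"
  shows permutable
proof -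
  define K where "K = {k. [k = 1] (mod 4) \<and> (\<exists>A. over k A)}"
  have K4: "\<forall>k\<in>K. [k = 1] (mod 4)" by (simp add: K_def)
  have K_ex: "\<exists>A. over k A" if "k \<in> K" for k using that by (simp add: K_def)
  have KI: "k \<in> K" if "over k A" "[k = 1] (mod 4)" for k A using that by (auto simp: K_def)
  show ?thesis
  \<comment> \<open>An exponent is determined only modulo \<open>N\<close>, so for \<open>N\<close>
    equal to \<open>1\<close> or \<open>2\<close> every element has one in \<open>K\<close>; the
    second case forces \<open>4 dvd N\<close>.\<close>
  proof (cases "\<forall>A\<in>G. \<exists>k\<in>K. over k A")
    case True
    then have all: "\<exists>k\<in>K. over k A" if "A \<in> G" for A using that by blast
    show ?thesis
    proof (cases rule: ex_two_adic_generator[of K n, OF K4])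
      case 1
      show ?thesis
      proof (rule permutable_cyclic[OF over_one])
        fix A assume "A \<in> G"
        then obtain k where k: "k \<in> K" "over k A" using all by blast
        have "[1 ^ 0 = k] (mod int N)" using cong_sym[OF 1[OF k(1)]] by (simp add: N)
        with k show "\<exists>k t. over k A \<and> [1 ^ t = k] (mod int N)" by blast
      qed
    next
      case (2 v u)
      obtain A0 where "over (1 + 2 ^ v * u) A0" using K_ex[OF 2(4)] ..
      then show ?thesis
      proof (rule permutable_cyclic)
        fix A assume "A \<in> G"
        then obtain k where k: "k \<in> K" "over k A" using all by blast
        have "\<exists>t. [(1 + 2 ^ v * u) ^ t = k] (mod int N)"
          using two_adic_generator[OF 2(1,2) 2(5)[OF k(1)], of n] by (simp add: N)
        with k show "\<exists>k t. over k A \<and> [(1 + 2 ^ v * u) ^ t = k] (mod int N)" by blast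
      qed
    qed
  next
    case False
    then obtain X where X: "X \<in> G" "\<And>k. k \<in> K \<Longrightarrow> \<not> over k X" by blast
    obtain b where b: "over b X" using ex_over[OF X(1)] ..
    have not1: "\<not> [k = 1] (mod 4)" if "over k X" for k using X(2) KI that by blast
    have "n \<noteq> 0"
    proof
      assume "n = 0"
      then have "over 1 X" by (intro over_cong[OF b]) (simp add: N)
      then show False using not1[OF \<open>over 1 X\<close>] by simp
    qed
    then have even_N: "2 dvd int N" by (simp add: N)
    have odd_over: "odd k" if k: "over k A" for k A
    proof -
      obtain k' where "[k * k' = 1] (mod int N)" using over_unit[OF k] ..
      then have "int N dvd k * k' - 1" by (simp add: cong_iff_dvd_diff)
      with even_N have "2 dvd k * k' - 1" by (rule dvd_trans)
      then show ?thesis by auto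
    qed
    have b3: "[b = 3] (mod 4)" using cong_4_odd[OF odd_over[OF b]] not1[OF b] by blast
    have "4 dvd int N"
    proof (rule ccontr)
      assume *: "\<not> 4 dvd int N"
      have "n = 1"
      proof (rule ccontr)
        assume "n \<noteq> 1"
        with \<open>n \<noteq> 0\<close> have "2 \<le> n" by simp
        then have "(2 :: int) ^ 2 dvd 2 ^ n" by (rule le_imp_power_dvd)
        with * show False by (simp add: N)
      qed
      then have "over 1 X" using odd_over[OF b] by (intro over_cong[OF b]) (simp add: N cong_iff_dvd_diff)
      then show False using not1[OF \<open>over 1 X\<close>] by simp
    qed
    then have cong4: "[x = y] (mod 4)" if "[x = y] (mod int N)" for x y
      using that cong_dvd_modulus by blast
    \<comment> \<open>The inverse of \<open>b\<close> is taken as the exponent of a group element,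
      so that \<open>k * b'\<close> is again an exponent.\<close>
    obtain Y where Y: "Y \<in> G" "X * Y = 1\<^sub>m N" using G_inverse[OF X(1)] by blast
    obtain b' where b': "over b' Y" using ex_over[OF Y(1)] ..
    have bb': "[b * b' = 1] (mod int N)" by (rule over_inverse[OF b Y b'])
    have b'3: "[b' = 3] (mod 4)"
    proof -
      have "[3 * b' = b * b'] (mod 4)" by (rule cong_scalar_right[OF cong_sym[OF b3]])
      also have "[b * b' = 1] (mod 4)" by (rule cong4[OF bb'])
      finally show ?thesis by (simp add: cong_def) presburger
    qed
    have three: "[x * y = 1] (mod 4)" if "[x = 3] (mod 4)" "[y = 3] (mod 4)" for x y :: int
      using cong_mult[OF that] by (simp add: cong_def)
    have three': "[x * y = 3] (mod 4)" if "[x = 1] (mod 4)" "[y = 3] (mod 4)" for x y :: int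
      using cong_mult[OF that] by (simp add: cong_def)
    have k_cases: "k \<in> K \<or> [k = 3] (mod 4)" if "over k A" for k A
      using cong_4_odd[OF odd_over[OF that]] KI[OF that] by blast
    \<comment> \<open>An exponent congruent to \<open>3\<close> modulo \<open>4\<close> falls into
      \<open>K\<close> after multiplication by \<open>b'\<close>, so it is an odd power of
      \<open>b\<close>.\<close>
    have b_gen: "\<exists>t. [b ^ t = k] (mod int N)"
      if gen: "\<And>k. k \<in> K \<Longrightarrow> \<exists>t. [(b * b) ^ t = k] (mod int N)" and k: "over k A" for k A
      using k_cases[OF k]
    proof
      assume "k \<in> K"
      then obtain t where "[(b * b) ^ t = k] (mod int N)" using gen by blast
      then have "[b ^ (2 * t) = k] (mod int N)" by (simp add: power_mult power2_eq_square)
      then show ?thesis by blast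
    next
      assume "[k = 3] (mod 4)"
      then have "k * b' \<in> K" using KI[OF over_mult[OF k b']] three b'3 by blast
      then obtain t where "[(b * b) ^ t = k * b'] (mod int N)" using gen by blast
      then have "[b * (b * b) ^ t = b * (k * b')] (mod int N)" by (rule cong_scalar_left)
      also have "b * (k * b') = k * (b * b')" by (simp add: ac_simps)
      also have "[k * (b * b') = k * 1] (mod int N)" by (rule cong_scalar_left[OF bb'])
      finally have "[b ^ Suc (2 * t) = k] (mod int N)" by (simp add: power_mult power2_eq_square)
      then show ?thesis by blast
    qed
    have cyclic: permutable if "\<And>k. k \<in> K \<Longrightarrow> \<exists>t. [(b * b) ^ t = k] (mod int N)"
      using permutable_cyclic[OF b] b_gen[OF that] ex_over by blast
    show ?thesis
    proof (cases rule: ex_two_adic_generator[of K n, OF K4])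
      case 1
      have "\<exists>t. [(b * b) ^ t = k] (mod int N)" if "k \<in> K" for k
        using cong_sym[OF 1[OF that]] by (intro exI[of _ 0]) (simp add: N)
      then show ?thesis by (rule cyclic)
    next
      case (2 v u)
      define l where "l = 1 + 2 ^ v * u"
      have gen: "\<exists>t. [l ^ t = k] (mod int N)" if "[k = 1] (mod 2 ^ v)" for k
        using two_adic_generator[OF 2(1,2) that, of n] by (simp add: N l_def)
      obtain A0 where A0: "over l A0" using K_ex[OF 2(4)] by (auto simp: l_def)
      show ?thesis
      \<comment> \<open>If \<open>- b\<close> is \<open>1\<close> modulo \<open>2 ^ v\<close>, then
        so is \<open>- b'\<close>; it is therefore a power of \<open>l\<close>, and multiplying by
        \<open>b\<close> exhibits \<open>-1\<close> as an exponent.\<close>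
      proof (cases "[- b = 1] (mod 2 ^ v)")
        case True
        have "(2 :: int) ^ v dvd int N" unfolding N of_nat_power using 2(3) by (simp add: le_imp_power_dvd)
        with bb' have "[b * b' = 1] (mod 2 ^ v)" by (rule cong_dvd_modulus)
        then have bb'_v: "[- b * - b' = 1] (mod 2 ^ v)" by (simp only: minus_mult_minus)
        have "[- b * - b' = 1 * - b'] (mod 2 ^ v)" by (rule cong_scalar_right[OF True])
        from cong_trans[OF cong_sym[OF this] bb'_v] have "[- b' = 1] (mod 2 ^ v)"
          by (simp only: mult_1_left)
        then obtain s where "[l ^ s = - b'] (mod int N)" using gen by blast
        then have "[b * l ^ s = b * - b'] (mod int N)" by (rule cong_scalar_left)
        also have "b * - b' = - (b * b')" by simp
        also have "[- (b * b') = - 1] (mod int N)" using bb' by (simp only: cong_minus_minus_iff)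
        finally have "[b * l ^ s = - 1] (mod int N)" .
        then have m1: "over (- 1) (X * A0 ^\<^sub>m s)" by (rule over_cong[OF over_mult[OF b over_pow[OF A0]]])
        show ?thesis
        proof (rule permutable_noncyclic[OF N l_def 2(1-3) A0 m1])
          fix A assume "A \<in> G"
          then obtain k where k: "over k A" using ex_over by blast
          from k_cases[OF k] show "\<exists>k t. over k A \<and> ([l ^ t = k] (mod int N) \<or> [- (l ^ t) = k] (mod int N))"
          proof
            assume "k \<in> K"
            then show ?thesis using gen[OF 2(5)] k by blast
          next
            assume "[k = 3] (mod 4)"
            moreover have "[- 1 = (3 :: int)] (mod 4)" by (simp add: cong_def)
            ultimately have "k * - 1 \<in> K" using KI[OF over_mult[OF k m1]] three by blast
            then obtain t where "[l ^ t = k * - 1] (mod int N)" using gen[OF 2(5)] by blast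
            then have "[- (l ^ t) = - (k * - 1)] (mod int N)" by (simp only: cong_minus_minus_iff)
            then have "[- (l ^ t) = k] (mod int N)" by simp
            then show ?thesis using k by blast
          qed
        qed
      next
        case False
        have "b + 1 \<noteq> 0"
        proof
          assume "b + 1 = 0"
          then have "b = - 1" by simp
          then show False using False by simp
        qed
        \<comment> \<open>Once \<open>w < v\<close> is known, the exact valuation of
          \<open>b * b - 1\<close> settles the case: it is \<open>w + 1\<close>, because
          \<open>b - 1\<close> is twice an odd number, and at least \<open>v\<close>, because
          \<open>b * b\<close> lies in \<open>K\<close>. So it is \<open>v\<close>, and
          \<open>b * b\<close> generates \<open>K\<close>.\<close>
        then obtain w c where w: "b + 1 = 2 ^ w * c" "odd c" by (rule odd_decomposition)
        have "w < v"
        proof (rule ccontr)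
          assume "\<not> w < v"
          then have "(2 :: int) ^ v dvd 2 ^ w" by (intro le_imp_power_dvd) simp
          then have "2 ^ v dvd b + 1" unfolding w(1) by simp
          then have "2 ^ v dvd - (b + 1)" by (simp only: dvd_minus_iff)
          also have "- (b + 1) = - b - 1" by simp
          finally show False using False by (simp add: cong_iff_dvd_diff)
        qed
        obtain q where q: "b - 3 = 4 * q" using b3 by (auto simp: cong_iff_dvd_diff)
        have "b * b - 1 = (b + 1) * (b - 1)" by (simp add: algebra_simps)
        also have "b - 1 = 2 * (2 * q + 1)" using q by simp
        finally have bb: "b * b - 1 = 2 ^ Suc w * (c * (2 * q + 1))" by (simp add: w(1))
        have "b * b \<in> K" using KI[OF over_mult[OF b b]] three b3 by blast
        then have "2 ^ v dvd 2 ^ Suc w * (c * (2 * q + 1))"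
          using 2(5)[of "b * b"] unfolding cong_iff_dvd_diff bb by blast
        moreover have "coprime ((2 :: int) ^ v) (c * (2 * q + 1))"
          using w(2) by (simp add: coprime_power_left_iff)
        ultimately have "(2 :: int) ^ v dvd 2 ^ Suc w" by (simp only: coprime_dvd_mult_left_iff)
        then have "v \<le> Suc w"
          using dvd_power_iff[of "2 :: int" v "Suc w"] by (simp del: power_Suc)
        with \<open>w < v\<close> have v: "v = Suc w" by simp
        have "b * b = 1 + 2 ^ v * (c * (2 * q + 1))" using bb unfolding v by simp
        moreover have "odd (c * (2 * q + 1))" using w(2) by simp
        ultimately have "\<exists>t. [(b * b) ^ t = k] (mod int N)" if "k \<in> K" for k
          using two_adic_generator[OF _ 2(2) 2(5)[OF that], of "c * (2 * q + 1)" n] by (simp add: N)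
        then show ?thesis by (rule cyclic)
      qed
    qed
  qed
qed

end

section \<open>Diagonalizing the maximal cycle\<close>

lemma cycle_of_list_nth:
  assumes "distinct cs" "t < length cs"
  shows "cycle_of_list cs (cs ! t) = cs ! (Suc t mod length cs)"
proof -
  have "map (cycle_of_list cs ^^ 1) cs = rotate 1 cs" by (rule cyclic_rotation[OF assms(1)])
  then have "map (cycle_of_list cs) cs ! t = rotate1 cs ! t" by simp
  then show ?thesis using assms(2) by (simp add: nth_rotate1)
qed

text \<open>The discrete Fourier transform with respect to positions in \<open>cs\<close> turns the
  step to the next position into multiplication by a root of unity.\<close>

lemma similar_perm_mat_cycle_diag_rot:
  assumes "N > 0" "distinct cs" "set cs = {0..<N}"
  shows "similar_mat (perm_mat N (cycle_of_list cs)) (diag_rot N 1)"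
proof -
  define \<sigma> where "\<sigma> = cycle_of_list cs"
  have len: "length cs = N" using distinct_card[OF assms(2)] assms(3) by simp
  have bij: "bij_betw ((!) cs) {..<N} {..<N}"
    by (rule bij_betw_nth[OF assms(2)]) (simp_all only: len assms(3) atLeast0LessThan)
  define pos where "pos = inv_into {..<N} ((!) cs)"
  have pos: "pos b < N" "cs ! pos b = b" if "b < N" for b
    using that bij_betwE[OF bij_betw_inv_into[OF bij]] bij_betw_inv_into_right[OF bij]
    unfolding pos_def by simp_all
  have pos_nth: "pos (cs ! t) = t" if "t < N" for t
    using that bij unfolding pos_def by (simp add: bij_betw_inv_into_left)
  \<comment> \<open>Only a congruence holds, because the last position is followed by
    \<open>0\<close>.\<close>
  have \<sigma>: "\<sigma> b < N" "[int (pos (\<sigma> b)) = int (pos b) + 1] (mod int N)" if "b < N" for b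
  proof -
    have e: "\<sigma> b = cs ! (Suc (pos b) mod N)"
      using cycle_of_list_nth[OF assms(2), of "pos b"] pos[OF that] by (simp add: \<sigma>_def len)
    have lt: "Suc (pos b) mod N < N" using assms(1) by simp
    show "\<sigma> b < N" using bij_betwE[OF bij] lt by (auto simp: e)
    show "[int (pos (\<sigma> b)) = int (pos b) + 1] (mod int N)"
      by (simp add: e pos_nth[OF lt] cong_def zmod_int add.commute)
  qed
  define Q where "Q = mat N N (\<lambda>(i, b). rot N (int i * int (pos b)))"
  define Q' where "Q' = mat N N (\<lambda>(b, i). rot N (- (int (pos b) * int i)) / of_nat N)"
  have Q: "Q \<in> carrier_mat N N" and Q': "Q' \<in> carrier_mat N N" by (simp_all add: Q_def Q'_def)
  have Q'Q: "Q' * Q = 1\<^sub>m N"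
  proof (rule eq_matI)
    show "dim_row (Q' * Q) = dim_row (1\<^sub>m N)" "dim_col (Q' * Q) = dim_col (1\<^sub>m N)"
      using Q Q' by auto
    fix b b' assume "b < dim_row (1\<^sub>m N :: complex mat)" "b' < dim_col (1\<^sub>m N :: complex mat)"
    then have b: "b < N" "b' < N" by auto
    have "(Q' * Q) $$ (b, b') = (\<Sum>i<N. Q' $$ (b, i) * Q $$ (i, b'))"
      by (rule index_mat_mult_sum[OF Q' Q b])
    also have "\<dots> = (\<Sum>i<N. rot N ((int (pos b') - int (pos b)) * int i) / of_nat N)"
    proof (rule sum.cong[OF refl])
      fix i assume "i \<in> {..<N}"
      have "rot N ((int (pos b') - int (pos b)) * int i)
          = rot N (- (int (pos b) * int i)) * rot N (int i * int (pos b'))"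
        by (simp add: algebra_simps flip: rot_add)
      then show "Q' $$ (b, i) * Q $$ (i, b') = rot N ((int (pos b') - int (pos b)) * int i) / of_nat N"
        using b \<open>i \<in> {..<N}\<close> by (simp add: Q_def Q'_def)
    qed
    also have "\<dots> = (\<Sum>i<N. rot N ((int (pos b') - int (pos b)) * int i)) / of_nat N"
      by (simp add: sum_divide_distrib)
    also have "\<dots> = (if b = b' then 1 else 0)"
    proof -
      have "b = b'" if "int N dvd int (pos b') - int (pos b)"
      proof -
        have "[int (pos b') = int (pos b)] (mod int N)" using that by (simp add: cong_iff_dvd_diff)
        then have "pos b' = pos b"
          using pos b by (simp add: cong_int_iff cong_less_modulus_unique_nat)
        then show ?thesis using pos(2)[OF b(1)] pos(2)[OF b(2)] by simp
      qed
      then show ?thesis using assms(1) by (auto simp: sum_rot[OF assms(1)])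
    qed
    finally show "(Q' * Q) $$ (b, b') = 1\<^sub>m N $$ (b, b')" using b by simp
  qed
  have QQ': "Q * Q' = 1\<^sub>m N" by (rule mat_mult_left_right_inverse[OF Q' Q Q'Q])
  have eq: "Q * perm_mat N \<sigma> = diag_rot N 1 * Q"
  proof (rule eq_matI)
    show "dim_row (Q * perm_mat N \<sigma>) = dim_row (diag_rot N 1 * Q)"
      "dim_col (Q * perm_mat N \<sigma>) = dim_col (diag_rot N 1 * Q)"
      using Q by auto
    fix i b assume "i < dim_row (diag_rot N 1 * Q)" "b < dim_col (diag_rot N 1 * Q)"
    then have ib: "i < N" "b < N" using Q by auto
    have "[int i * int (pos (\<sigma> b)) = int i * (int (pos b) + 1)] (mod int N)"
      by (rule cong_scalar_left[OF \<sigma>(2)[OF ib(2)]])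
    then have "rot N (int i * int (pos (\<sigma> b))) = rot N (int i * (int (pos b) + 1))"
      by (simp add: rot_eq_iff[OF assms(1)])
    also have "\<dots> = rot N (1 * int i) * rot N (int i * int (pos b))"
      by (simp add: algebra_simps flip: rot_add)
    finally show "(Q * perm_mat N \<sigma>) $$ (i, b) = (diag_rot N 1 * Q) $$ (i, b)"
      unfolding mult_perm_mat_index[where \<tau> = \<sigma>, OF Q \<sigma>(1)[OF ib(2)] ib]
        diag_rot_mult_index[OF Q ib]
      using ib \<sigma>(1) by (simp add: Q_def)
  qed
  have "Q' * diag_rot N 1 * Q = Q' * (Q * perm_mat N \<sigma>)"
    unfolding eq by (rule assoc_mult_mat[OF Q' diag_rot_carrier Q])
  also have "\<dots> = Q' * Q * perm_mat N \<sigma>" by (rule assoc_mult_mat[OF Q' Q perm_mat_carrier, symmetric])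
  also have "\<dots> = perm_mat N \<sigma>" unfolding Q'Q by (rule left_mult_one_mat[OF perm_mat_carrier])
  finally show ?thesis
    by (intro similar_matI[of _ _ Q' Q N]) (use Q Q' Q'Q QQ' in \<open>simp_all add: \<sigma>_def\<close>)
qed

section \<open>Products and inverses in the general linear group\<close>

lemma GL_mult [simp]: "A \<otimes>\<^bsub>GL d\<^esub> B = A * B"
  by (simp add: GL_def units_of_mult ring_mat_simps)

lemma GL_one [simp]: "\<one>\<^bsub>GL d\<^esub> = 1\<^sub>m d"
  by (simp add: GL_def units_of_one ring_mat_simps)

lemma GL_carrier_mat: "A \<in> carrier (GL d) \<Longrightarrow> A \<in> carrier_mat d d"
  by (simp add: carrier_GL)

lemma GL_I:
  assumes "A \<in> carrier_mat d d" "B \<in> carrier_mat d d" "A * B = 1\<^sub>m d" "B * A = 1\<^sub>m d"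
  shows "A \<in> carrier (GL d)"
  unfolding carrier_GL using assms
  by (auto simp: invertible_mat_def inverts_mat_def intro!: exI[of _ B])

lemma GL_inv_closed: "A \<in> carrier (GL d) \<Longrightarrow> inv\<^bsub>GL d\<^esub> A \<in> carrier_mat d d"
  using group.inv_closed[OF group_GL] GL_carrier_mat by blast

lemma GL_inv_mult:
  assumes "A \<in> carrier (GL d)"
  shows "inv\<^bsub>GL d\<^esub> A * A = 1\<^sub>m d" "A * inv\<^bsub>GL d\<^esub> A = 1\<^sub>m d"
  using group.l_inv[OF group_GL assms] group.r_inv[OF group_GL assms] by simp_all

lemma GL_inv_eq:
  assumes "A \<in> carrier_mat d d" "B \<in> carrier_mat d d" "A * B = 1\<^sub>m d" "B * A = 1\<^sub>m d"
  shows "inv\<^bsub>GL d\<^esub> A = B"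
  by (rule group.inv_equality[OF group_GL]) (use GL_I assms in auto)

text \<open>Conjugation by an eigenbasis \<open>S\<close> of \<open>C\<close> makes the group a
  \<open>monomial_group\<close>, to which \<open>permutable_power_of_two\<close> applies. The matrix
  \<open>T\<close> found there is carried back as \<open>S * T\<close>.\<close>

theorem theorem1p1:
  fixes n :: nat and \<G> :: "complex mat set" and C :: "complex mat"
  assumes "n > 0"
    and "permutation_like_matrix_group (2 ^ n) \<G>"
    and "C \<in> \<G>"
    and "maximal_cycle (2 ^ n) C"
    and "generate (GL (2 ^ n)) {C} \<lhd> (GL (2 ^ n))\<lparr>carrier := \<G>\<rparr>"
  shows "permutation_matrix_group (2 ^ n) \<G>"
proof -
  define N where "N = (2 :: nat) ^ n"
  have N_pos: "N > 0" by (simp add: N_def)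
  have sub: "subgroup \<G> (GL N)"
    and like: "\<And>A. A \<in> \<G> \<Longrightarrow> \<exists>T\<in>carrier (GL N). is_permutation_matrix N (inv\<^bsub>GL N\<^esub> T * A * T)"
    using assms(2) by (auto simp: permutation_like_matrix_group_def N_def)
  have normal: "generate (GL N) {C} \<lhd> (GL N)\<lparr>carrier := \<G>\<rparr>" using assms(5) by (simp add: N_def)
  have GGL: "A \<in> carrier (GL N)" if "A \<in> \<G>" for A using subgroup.mem_carrier[OF sub that] .
  have Gc: "A \<in> carrier_mat N N" if "A \<in> \<G>" for A using GL_carrier_mat[OF GGL[OF that]] .
  have Gm: "A * B \<in> \<G>" if "A \<in> \<G>" "B \<in> \<G>" for A B using subgroup.m_closed[OF sub that] by simp
  have Gi: "inv\<^bsub>GL N\<^esub> A \<in> \<G>" if "A \<in> \<G>" for A using subgroup.m_inv_closed[OF sub that] .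
  have G1: "1\<^sub>m N \<in> \<G>" using subgroup.one_closed[OF sub] by simp
  obtain cs where cs: "distinct cs" "set cs = {0..<N}" "similar_mat C (perm_mat N (cycle_of_list cs))"
    using assms(4) by (auto simp: maximal_cycle_def N_def)
  have "similar_mat C (diag_rot N 1)"
    by (rule similar_mat_trans[OF cs(3) similar_perm_mat_cycle_diag_rot[OF N_pos cs(1,2)]])
  then obtain S S' where wit: "similar_mat_wit C (diag_rot N 1) S S'" by (auto simp: similar_mat_def)
  note w = similar_mat_witD2[OF Gc[OF assms(3)] wit]
  note S = w(6) and S' = w(7) and SS' = w(1) and S'S = w(2) and C = w(3)
  note assoc = assoc_mult_mat[of _ N N _ N _ N]
  define cj where "cj A = S' * A * S" for A
  have cj_carrier: "cj A \<in> carrier_mat N N" if "A \<in> carrier_mat N N" for A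
    using that S S' by (simp add: cj_def)
  have cj_mult: "cj (A * B) = cj A * cj B" if A: "A \<in> carrier_mat N N" and B: "B \<in> carrier_mat N N" for A B
  proof -
    have "cj A * cj B = S' * A * (S * S') * B * S"
      using A B S S' unfolding cj_def by (simp add: assoc)
    also have "S' * A * (S * S') = S' * A" unfolding SS' using A S' by simp
    finally show ?thesis using A B S S' by (simp add: cj_def assoc)
  qed
  have cj_one: "cj (1\<^sub>m N) = 1\<^sub>m N" using S' S'S by (simp add: cj_def)
  have cj_C: "cj C = diag_rot N 1"
  proof -
    define D where "D = diag_rot N 1"
    have D: "D \<in> carrier_mat N N" by (simp add: D_def)
    have "cj C = S' * S * D * (S' * S)"
      using S S' D unfolding cj_def C D_def[symmetric] by (simp add: assoc)
    then show ?thesis unfolding S'S using left_mult_one_mat[OF D] right_mult_one_mat[OF D] by (simp add: D_def)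
  qed
  \<comment> \<open>Following the generation of the cyclic subgroup shows that it consists of
    matrices \<open>diag_rot N k\<close> after conjugation, which lets normality be read as a
    commutation rule.\<close>
  have cj_generate: "\<exists>k. cj Y = diag_rot N k" if "Y \<in> generate (GL N) {C}" for Y
    using that
  proof induction
    case one
    show ?case using cj_one by (intro exI[of _ 0]) simp
  next
    case (incl h)
    then show ?case using cj_C by auto
  next
    case (inv h)
    then have h: "h = C" by simp
    have iC: "inv\<^bsub>GL N\<^esub> C \<in> carrier_mat N N" by (rule Gc[OF Gi[OF assms(3)]])
    have "cj (inv\<^bsub>GL N\<^esub> C) * diag_rot N 1 = 1\<^sub>m N"
      using cj_mult[OF iC Gc[OF assms(3)]] GL_inv_mult[OF GGL[OF assms(3)]] by (simp add: cj_C cj_one)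
    then have "cj (inv\<^bsub>GL N\<^esub> C) * diag_rot N 1 * diag_rot N (- 1) = diag_rot N (- 1)"
      using left_mult_one_mat[OF diag_rot_carrier] by simp
    then have "cj (inv\<^bsub>GL N\<^esub> C) = diag_rot N (- 1)"
      using assoc_mult_mat[OF cj_carrier[OF iC] diag_rot_carrier diag_rot_carrier]
        right_mult_one_mat[OF cj_carrier[OF iC]] by (simp add: diag_rot_mult)
    then show ?case unfolding h by blast
  next
    case (eng h1 h2)
    have "generate (GL N) {C} \<subseteq> carrier (GL N)"
      using group.generate_incl[OF group_GL, of "{C}"] GGL[OF assms(3)] by simp
    then have "h1 \<in> carrier_mat N N" "h2 \<in> carrier_mat N N" using eng GL_carrier_mat by blast+
    then show ?case using eng.IH cj_mult by (auto simp: diag_rot_mult)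
  qed
  interpret monomial_group N "cj ` \<G>"
  proof
    show "N > 0" by (rule N_pos)
    show "A \<in> carrier_mat N N" if "A \<in> cj ` \<G>" for A using that Gc cj_carrier by auto
    show "A * B \<in> cj ` \<G>" if "A \<in> cj ` \<G>" "B \<in> cj ` \<G>" for A B
      using that Gc Gm by (auto simp flip: cj_mult)
    show "\<exists>B\<in>cj ` \<G>. A * B = 1\<^sub>m N \<and> B * A = 1\<^sub>m N" if "A \<in> cj ` \<G>" for A
    proof -
      obtain X where X: "X \<in> \<G>" "A = cj X" using \<open>A \<in> cj ` \<G>\<close> by auto
      have "cj X * cj (inv\<^bsub>GL N\<^esub> X) = 1\<^sub>m N" "cj (inv\<^bsub>GL N\<^esub> X) * cj X = 1\<^sub>m N"
        using X(1) GL_inv_mult[OF GGL[OF X(1)]] Gi Gc by (simp_all add: cj_one flip: cj_mult)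
      then show ?thesis using X Gi by blast
    qed
    show "diag_rot N j \<in> cj ` \<G>" for j
    proof -
      \<comment> \<open>Products reach the natural exponents; any other exponent is replaced by its
        residue modulo \<open>N\<close>.\<close>
      have "diag_rot N (int m) \<in> cj ` \<G>" for m
      proof (induction m)
        case 0
        show ?case using cj_one G1 by (metis diag_rot_0 image_eqI of_nat_0)
      next
        case (Suc m)
        then obtain X where X: "X \<in> \<G>" "diag_rot N (int m) = cj X" by auto
        have "diag_rot N (int (Suc m)) = cj X * cj C"
          unfolding X(2)[symmetric] cj_C diag_rot_mult by (simp add: add.commute)
        also have "\<dots> = cj (X * C)" by (rule cj_mult[OF Gc[OF X(1)] Gc[OF assms(3)], symmetric])
        finally show ?case using Gm[OF X(1) assms(3)] by blast
      qed
      moreover have "diag_rot N j = diag_rot N (int (nat (j mod int N)))"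
      proof -
        have "rot N (j * int i) = rot N (j mod int N * int i)" for i
          using N_pos by (simp add: rot_eq_iff cong_def mod_mult_left_eq)
        then show ?thesis using N_pos by (simp add: diag_rot_def)
      qed
      ultimately show ?thesis by (simp only:)
    qed
    show "\<exists>k. diag_rot N 1 * A = A * diag_rot N k" if "A \<in> cj ` \<G>" for A
    proof -
      obtain X where X: "X \<in> \<G>" "A = cj X" using \<open>A \<in> cj ` \<G>\<close> by auto
      \<comment> \<open>By normality \<open>Y\<close> lies in the subgroup generated by
        \<open>C\<close>, and \<open>X * Y = C * X\<close> is the required relation before
        conjugation.\<close>
      define Y where "Y = inv\<^bsub>GL N\<^esub> X * C * X"
      have iX: "inv\<^bsub>GL N\<^esub> X \<in> carrier_mat N N" by (rule Gc[OF Gi[OF X(1)]])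
      note c = iX Gc[OF X(1)] Gc[OF assms(3)]
      have "inv\<^bsub>GL N\<lparr>carrier := \<G>\<rparr>\<^esub> X \<otimes>\<^bsub>GL N\<lparr>carrier := \<G>\<rparr>\<^esub> C \<otimes>\<^bsub>GL N\<lparr>carrier := \<G>\<rparr>\<^esub> X
          \<in> generate (GL N) {C}"
        by (rule normal.inv_op_closed1[OF normal]) (simp_all add: X(1) generate.incl)
      then have "Y \<in> generate (GL N) {C}"
        by (simp add: Y_def group.m_inv_consistent[OF group_GL sub X(1)])
      then obtain k where k: "cj Y = diag_rot N k" using cj_generate by blast
      have "X * Y = X * inv\<^bsub>GL N\<^esub> X * C * X" using c by (simp add: Y_def assoc)
      also have "\<dots> = C * X" using c GL_inv_mult[OF GGL[OF X(1)]] by simp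
      finally have "cj (X * Y) = cj (C * X)" by simp
      moreover have "Y \<in> carrier_mat N N" using c by (simp add: Y_def)
      ultimately have "cj X * cj Y = cj C * cj X" using c by (simp add: cj_mult)
      then have "diag_rot N 1 * cj X = cj X * diag_rot N k" by (simp add: k cj_C)
      then show ?thesis using X(2) by blast
    qed
    show "\<exists>\<sigma>. \<sigma> permutes {0..<N} \<and> similar_mat A (perm_mat N \<sigma>)" if "A \<in> cj ` \<G>" for A
    proof -
      obtain X where X: "X \<in> \<G>" "A = cj X" using \<open>A \<in> cj ` \<G>\<close> by auto
      obtain T where T: "T \<in> carrier (GL N)" "is_permutation_matrix N (inv\<^bsub>GL N\<^esub> T * X * T)"
        using like[OF X(1)] by blast
      then obtain \<sigma> where \<sigma>: "\<sigma> permutes {0..<N}" "inv\<^bsub>GL N\<^esub> T * X * T = perm_mat N \<sigma>"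
        by (auto simp: is_permutation_matrix_def)
      note c = GL_carrier_mat[OF T(1)] GL_inv_closed[OF T(1)] Gc[OF X(1)]
      have "similar_mat (perm_mat N \<sigma>) X"
        by (rule similar_matI[of _ _ "inv\<^bsub>GL N\<^esub> T" T N])
          (use c GL_inv_mult[OF T(1)] \<sigma>(2) in auto)
      moreover have "similar_mat (cj X) X"
        by (rule similar_matI[of _ _ S' S N]) (use c S S' SS' S'S in \<open>auto simp: cj_def\<close>)
      ultimately have "similar_mat (cj X) (perm_mat N \<sigma>)"
        using similar_mat_sym similar_mat_trans by blast
      then show ?thesis using \<sigma>(1) X(2) by blast
    qed
  qed
  obtain T T' where T: "T \<in> carrier_mat N N" "T' \<in> carrier_mat N N" "T * T' = 1\<^sub>m N" "T' * T = 1\<^sub>m N"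
    and perm: "\<And>A. A \<in> \<G> \<Longrightarrow> is_permutation_matrix N (T' * cj A * T)"
    using permutable_power_of_two[OF N_def] unfolding permutable_def by blast
  have U: "S * T \<in> carrier_mat N N" "T' * S' \<in> carrier_mat N N" using S S' T by auto
  have "S * T * (T' * S') = S * (T * T') * S'" using S S' T(1,2) by (simp add: assoc)
  then have U1: "S * T * (T' * S') = 1\<^sub>m N" unfolding T(3) using S SS' by simp
  have U2: "T' * S' * (S * T) = 1\<^sub>m N" by (rule mat_mult_left_right_inverse[OF U U1])
  have "is_permutation_matrix N (inv\<^bsub>GL N\<^esub> (S * T) * A * (S * T))" if A: "A \<in> \<G>" for A
  proof -
    have "T' * S' * A * (S * T) = T' * cj A * T"
      using S S' T(1,2) Gc[OF A] by (simp add: cj_def assoc)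
    then show ?thesis using perm[OF A] GL_inv_eq[OF U U1 U2] by simp
  qed
  then show ?thesis
    using sub GL_I[OF U U1 U2] unfolding permutation_matrix_group_def N_def by blast
qed

end
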